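(* Let $\mathbb K\in\{\mathbb R,\mathbb C\}$, let $X$ be an infinite dimensional $\mathbb K$-Banach space and let $n\in\mathbb N$ (so $n\geq1$). Then $\mathcal I_n(X):=\{Q\in\mathcal I(X):\dim Q(X)=n\}$ and $\mathscr G_n(X):=\{E\in\mathscr G(X):\dim E=n\}$ are connected components of $\mathcal I(X)$ and $\mathscr G(X)$, respectively.
   Context: $\mathcal L(X,Y)$ is the Banach space of bounded $\mathbb K$-linear operators, $\mathcal L(X)=\mathcal L(X,X)$. $\mathcal I(X)=\{Q\in\mathcal L(X)\setminus\{0,I\}:Q^2=Q\}$ with the norm topology. $\mathscr G(X)$ is the set of all non-zero proper closed complemented subspaces of $X$. For $F\in\mathscr G(X)$, $\mathcal C_F$ is the set of closed complements of $F$ in $X$. For $E\in\mathcal C_F$ the map $q_{E,F}:\mathcal L(E,F)\to\mathcal C_F$, $q_{E,F}(T)=(I+T)(E)$, is a bijection with inverse $p_{E,F}$. $\mathscr G(X)$ carries the Hausdorff metrizable topology in which each $\mathcal C_F$ is open and each $p_{E,F}:\mathcal C_F\to\mathcal L(E,F)$ is a homeomorphism. *)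

theory Defs
  imports "HOL-Analysis.Analysis"
begin

text \<open>
  The scalar field \<open>\<bbbK>\<close>: a normed field that is isometrically isomorphic to
  \<open>\<real>\<close> or to \<open>\<complex>\<close>.
\<close>

class real_or_complex = real_normed_field +
  assumes real_or_complex:
    "(\<exists>\<phi> :: 'a \<Rightarrow> real. bij \<phi> \<and> (\<forall>a b. \<phi> (a + b) = \<phi> a + \<phi> b) \<and>
        (\<forall>a b. \<phi> (a * b) = \<phi> a * \<phi> b) \<and> (\<forall>a. norm (\<phi> a) = norm a)) \<or>
     (\<exists>\<phi> :: 'a \<Rightarrow> complex. bij \<phi> \<and> (\<forall>a b. \<phi> (a + b) = \<phi> a + \<phi> b) \<and>
        (\<forall>a b. \<phi> (a * b) = \<phi> a * \<phi> b) \<and> (\<forall>a. norm (\<phi> a) = norm a))"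

instance real :: real_or_complex
  by standard (rule disjI1, rule exI[of _ "\<lambda>x. x"], simp add: bij_def)

instance complex :: real_or_complex
  by standard (rule disjI2, rule exI[of _ "\<lambda>x. x"], simp add: bij_def)

text \<open>
  Class \<open>banach\<close> provides the complete norm and the underlying real structure of \<open>X\<close>;
  \<open>scale\<close> is the multiplication by scalars from \<open>\<bbbK>\<close>, which extends the real one.
\<close>

locale banach_space_over = vector_space scale
  for scale :: "'k::real_or_complex \<Rightarrow> 'a::banach \<Rightarrow> 'a" +
  assumes norm_scale: "norm (scale c x) = norm c * norm x"
    and scale_of_real: "scale (of_real r) x = r *\<^sub>R x"
begin

definition infinite_dimensional :: bool where
  "infinite_dimensional \<longleftrightarrow> \<not> (\<exists>B. finite B \<and> span B = UNIV)"

text \<open>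
  Elements of type \<open>'a \<Rightarrow>\<^sub>L 'a\<close> are bounded and real-linear; \<open>\<bbbK>\<close>-linearity has to be
  imposed.  The norm of this type is the operator norm, whatever the scalars are.
\<close>

definition bounded_operators :: "('a \<Rightarrow>\<^sub>L 'a) set" where
  "bounded_operators =
     {Q. \<forall>c x. blinfun_apply Q (scale c x) = scale c (blinfun_apply Q x)}"

definition idempotents :: "('a \<Rightarrow>\<^sub>L 'a) set" where
  "idempotents = {Q \<in> bounded_operators - {0, id_blinfun}. Q o\<^sub>L Q = Q}"

definition idempotents_of_rank :: "nat \<Rightarrow> ('a \<Rightarrow>\<^sub>L 'a) set" where
  "idempotents_of_rank n = {Q \<in> idempotents. dim (range (blinfun_apply Q)) = n}"

definition closed_complements :: "'a set \<Rightarrow> 'a set set" where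
  "closed_complements F =
     {E. subspace E \<and> closed E \<and> E \<inter> F = {0} \<and> {x + y |x y. x \<in> E \<and> y \<in> F} = UNIV}"

definition grassmannian :: "'a set set" where
  "grassmannian =
     {F. subspace F \<and> closed F \<and> F \<noteq> {0} \<and> F \<noteq> UNIV \<and> closed_complements F \<noteq> {}}"

definition grassmannian_of_dim :: "nat \<Rightarrow> 'a set set" where
  "grassmannian_of_dim n = {E \<in> grassmannian. dim E = n}"

text \<open>
  Bounded \<open>\<bbbK>\<close>-linear operators between the subspaces \<open>E\<close> and \<open>F\<close>, with the metric of the
  operator norm. An operator on \<open>E\<close> is represented by its extension by \<open>0\<close> outside \<open>E\<close>,
  so that it is determined by its values on \<open>E\<close>. The value \<open>0\<close> of the metric outside
  its carrier is irrelevant, but \<open>Metric_space\<close> demands nonnegativity for all arguments.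
\<close>

definition operators_between :: "'a set \<Rightarrow> 'a set \<Rightarrow> ('a \<Rightarrow> 'a) set" where
  "operators_between E F =
     {T. T \<in> E \<rightarrow> F \<and> (\<forall>x. x \<notin> E \<longrightarrow> T x = 0) \<and>
         (\<forall>x\<in>E. \<forall>y\<in>E. T (x + y) = T x + T y) \<and>
         (\<forall>c. \<forall>x\<in>E. T (scale c x) = scale c (T x)) \<and>
         (\<exists>B. \<forall>x\<in>E. norm (T x) \<le> B * norm x)}"

definition operator_dist ::
  "'a set \<Rightarrow> 'a set \<Rightarrow> ('a \<Rightarrow> 'a) \<Rightarrow> ('a \<Rightarrow> 'a) \<Rightarrow> real" where
  "operator_dist E F S T =
     (if S \<in> operators_between E F \<and> T \<in> operators_between E F
      then (SUP x\<in>E. norm (S x - T x) / norm x) else 0)"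

definition operator_topology :: "'a set \<Rightarrow> 'a set \<Rightarrow> ('a \<Rightarrow> 'a) topology" where
  "operator_topology E F = Metric_space.mtopology (operators_between E F) (operator_dist E F)"

definition graph_map :: "'a set \<Rightarrow> ('a \<Rightarrow> 'a) \<Rightarrow> 'a set" where
  "graph_map E T = (\<lambda>x. x + T x) ` E"

text \<open>
  \<open>graph_map E\<close> on \<open>operators_between E F\<close> is the inverse of the chart with domain
  \<open>closed_complements F\<close>. These domains cover the Grassmannian. Hence, in a topology where
  they are open and the charts are homeomorphisms, a set is open iff its part in every chart
  domain has an open image in the operator space. This determines the topology and serves as
  its definition.
\<close>

definition grassmannian_topology :: "'a set topology" where
  "grassmannian_topology = topology (\<lambda>U. U \<subseteq> grassmannian \<and>
     (\<forall>F\<in>grassmannian. \<forall>E\<in>closed_complements F.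
        openin (operator_topology E F) {T \<in> operators_between E F. graph_map E T \<in> U}))"

lemma bdd_above_operator_dist:
  assumes "S \<in> operators_between E F" "T \<in> operators_between E F"
  shows "bdd_above ((\<lambda>x. norm (S x - T x) / norm x) ` E)"
proof -
  obtain B where B: "\<And>x. x \<in> E \<Longrightarrow> norm (S x) \<le> B * norm x"
    using assms(1) unfolding operators_between_def by blast
  obtain C where C: "\<And>x. x \<in> E \<Longrightarrow> norm (T x) \<le> C * norm x"
    using assms(2) unfolding operators_between_def by blast
  have "norm (S x - T x) / norm x \<le> max 0 (B + C)" if "x \<in> E" for x
  proof (cases "x = 0")
    case False
    have "norm (S x - T x) \<le> norm (S x) + norm (T x)"
      by (rule norm_triangle_ineq4)
    also have "\<dots> \<le> (B + C) * norm x"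
      using B[OF that] C[OF that] by (simp add: distrib_right)
    finally show ?thesis
      using False by (simp add: pos_divide_le_eq le_max_iff_disj)
  qed simp
  then show ?thesis
    by (auto simp: bdd_above_def)
qed

lemma Metric_space_operators:
  assumes E: "subspace E"
  shows "Metric_space (operators_between E F) (operator_dist E F)"
proof
  have E0: "0 \<in> E"
    using E by (rule subspace_0)
  have upper: "norm (S x - T x) / norm x \<le> operator_dist E F S T"
    if "S \<in> operators_between E F" "T \<in> operators_between E F" "x \<in> E" for S T x
    using that cSUP_upper[OF that(3) bdd_above_operator_dist[OF that(1,2)]]
    by (simp add: operator_dist_def)
  fix R S T :: "'a \<Rightarrow> 'a"
  show "operator_dist E F S T = operator_dist E F T S"
    by (simp add: operator_dist_def norm_minus_commute)
  show "0 \<le> operator_dist E F S T"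
    using upper[of S T 0] E0 by (cases "S \<in> operators_between E F \<and> T \<in> operators_between E F")
      (auto simp: operator_dist_def)
  show "operator_dist E F S T = 0 \<longleftrightarrow> S = T"
    if ST: "S \<in> operators_between E F" "T \<in> operators_between E F"
  proof
    assume 0: "operator_dist E F S T = 0"
    show "S = T"
    proof
      fix x
      show "S x = T x"
      proof (cases "x \<in> E \<and> x \<noteq> 0")
        case True
        then show ?thesis
          using upper[OF ST, of x] 0 by (simp add: divide_le_0_iff)
      next
        case False
        have zero: "U 0 = 0" if "U \<in> operators_between E F" for U
        proof -
          have "U (0 + 0) = U 0 + U 0"
            using that E0 unfolding operators_between_def by blast
          then show ?thesis
            by simp
        qed
        then show ?thesis
        proof (cases "x = 0")
          case True
          then show ?thesis
            using zero[OF ST(1)] zero[OF ST(2)] by simp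
        next
          case False
          then have "x \<notin> E"
            using \<open>\<not> (x \<in> E \<and> x \<noteq> 0)\<close> by simp
          then show ?thesis
            using ST by (simp add: operators_between_def)
        qed
      qed
    qed
  next
    assume "S = T"
    moreover have "E \<noteq> {}"
      using E0 by blast
    ultimately show "operator_dist E F S T = 0"
      by (simp add: operator_dist_def)
  qed
  show "operator_dist E F R T \<le> operator_dist E F R S + operator_dist E F S T"
    if RST: "R \<in> operators_between E F" "S \<in> operators_between E F"
      "T \<in> operators_between E F"
  proof -
    have "norm (R x - T x) / norm x \<le> operator_dist E F R S + operator_dist E F S T"
      if "x \<in> E" for x
    proof -
      have "norm (R x - T x) / norm x \<le> norm (R x - S x) / norm x + norm (S x - T x) / norm x"
        using norm_triangle_ineq[of "R x - S x" "S x - T x"]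
        by (simp add: divide_right_mono flip: add_divide_distrib)
      also have "\<dots> \<le> operator_dist E F R S + operator_dist E F S T"
        using upper RST that by (intro add_mono) auto
      finally show ?thesis .
    qed
    then have "(SUP x\<in>E. norm (R x - T x) / norm x)
        \<le> operator_dist E F R S + operator_dist E F S T"
      using E0 by (intro cSUP_least) auto
    then show ?thesis
      using RST by (simp add: operator_dist_def)
  qed
qed

lemma istopology_grassmannian:
  "istopology (\<lambda>U. U \<subseteq> grassmannian \<and>
     (\<forall>F\<in>grassmannian. \<forall>E\<in>closed_complements F.
        openin (operator_topology E F) {T \<in> operators_between E F. graph_map E T \<in> U}))"
  unfolding istopology_def
proof (intro conjI allI impI ballI)
  fix S T F E
  assume "S \<subseteq> grassmannian \<and> (\<forall>F\<in>grassmannian. \<forall>E\<in>closed_complements F.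
      openin (operator_topology E F) {T \<in> operators_between E F. graph_map E T \<in> S})"
    and "T \<subseteq> grassmannian \<and> (\<forall>F\<in>grassmannian. \<forall>E\<in>closed_complements F.
      openin (operator_topology E F) {U \<in> operators_between E F. graph_map E U \<in> T})"
    and "F \<in> grassmannian" "E \<in> closed_complements F"
  then have "openin (operator_topology E F)
     ({R \<in> operators_between E F. graph_map E R \<in> S} \<inter>
      {R \<in> operators_between E F. graph_map E R \<in> T})"
    by (intro openin_Int) simp_all
  moreover have "\<dots> = {R \<in> operators_between E F. graph_map E R \<in> S \<inter> T}"
    by blast
  ultimately show "openin (operator_topology E F)
     {R \<in> operators_between E F. graph_map E R \<in> S \<inter> T}"
    by simp
next
  fix \<K> F E
  assume K: "\<forall>K\<in>\<K>. K \<subseteq> grassmannian \<and> (\<forall>F\<in>grassmannian. \<forall>E\<in>closed_complements F.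
      openin (operator_topology E F) {T \<in> operators_between E F. graph_map E T \<in> K})"
    and FE: "F \<in> grassmannian" "E \<in> closed_complements F"
  have "openin (operator_topology E F)
     (\<Union>K\<in>\<K>. {R \<in> operators_between E F. graph_map E R \<in> K})"
    using K FE by (intro openin_Union) auto
  moreover have "(\<Union>K\<in>\<K>. {R \<in> operators_between E F. graph_map E R \<in> K})
     = {R \<in> operators_between E F. graph_map E R \<in> \<Union>\<K>}"
    by blast
  ultimately show "openin (operator_topology E F)
     {R \<in> operators_between E F. graph_map E R \<in> \<Union>\<K>}"
    by simp
qed auto

lemma openin_grassmannian_topology:
  "openin grassmannian_topology U \<longleftrightarrow> U \<subseteq> grassmannian \<and>
     (\<forall>F\<in>grassmannian. \<forall>E\<in>closed_complements F.
        openin (operator_topology E F) {T \<in> operators_between E F. graph_map E T \<in> U})"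
  unfolding grassmannian_topology_def topology_inverse'[OF istopology_grassmannian] ..

end

end

theory Submission
  imports Defs
begin

text \<open>
  Two idempotents at distance less than \<open>1\<close> are each injective on the range of the other, so if
  one of them has finite rank, then the other has the same rank (\<open>rank_locally_constant\<close>). Hence
  the idempotents of rank \<open>n\<close> are open and closed in the set of all idempotents, and it remains to
  connect any two of them. If two idempotents \<open>P\<close> and \<open>Q\<close> have the same range, or the same kernel,
  then the whole segment from \<open>P\<close> to \<open>Q\<close> consists of idempotents
  (\<open>connected_component_segment\<close>). In an infinite dimensional space there is an
  \<open>n\<close>-dimensional subspace \<open>G\<close> that meets both \<open>P(X)\<close> and \<open>Q(X)\<close> only in \<open>0\<close>. Two
  complementary \<open>n\<close>-dimensional subspaces \<open>P(X)\<close> and \<open>G\<close> of a \<open>2n\<close>-dimensional space have a common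
  complement there, the span of the differences of corresponding basis vectors; bounded functionals
  extend this to a common closed complement in \<open>X\<close>. So \<open>P\<close> can be moved to an idempotent with the
  same range, from there along a fixed kernel to an idempotent with range \<open>G\<close>, and the same for
  \<open>Q\<close>; the two idempotents with range \<open>G\<close> are joined by a segment.

  The map \<open>Q \<mapsto> Q(X)\<close> from the idempotents of rank \<open>n\<close> onto the \<open>n\<close>-dimensional subspaces is
  continuous (\<open>continuous_map_range\<close>): in the chart at \<open>P(X)\<close> along the kernel of \<open>P\<close>, for \<open>Q\<close>
  close to \<open>P\<close>, the subspace \<open>Q(X)\<close> is the graph of \<open>(P|Q(X))\<^sup>-\<^sup>1 - I\<close>, an operator of norm at
  most \<open>2 \<parallel>Q - P\<parallel>\<close>. This makes the \<open>n\<close>-dimensional part of the Grassmannian connected. It is open and closed because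
  \<open>x \<mapsto> x + T x\<close> is injective on the domain \<open>E\<close> of a chart operator \<open>T\<close>, so that all subspaces in the
  chart domain have the dimension of \<open>E\<close>.

  Everything rests on a supply of bounded functionals: every finite independent set has a
  biorthogonal family of them (\<open>exists_dual_functionals\<close>), by the Hahn-Banach theorem.
\<close>

section \<open>Norming functionals by minimal sublinear functions\<close>

definition sublinear :: "('a::real_vector \<Rightarrow> real) \<Rightarrow> bool" where
  "sublinear p \<longleftrightarrow> (\<forall>x y. p (x + y) \<le> p x + p y) \<and> (\<forall>c\<ge>0. \<forall>x. p (c *\<^sub>R x) = c * p x)"

lemma sublinear_add: "sublinear p \<Longrightarrow> p (x + y) \<le> p x + p y"
  and sublinear_scaleR: "sublinear p \<Longrightarrow> c \<ge> 0 \<Longrightarrow> p (c *\<^sub>R x) = c * p x"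
  by (simp_all add: sublinear_def)

lemma sublinear_zero: "sublinear p \<Longrightarrow> p 0 = 0"
  using sublinear_scaleR[of p 0 0] by simp

lemma sublinear_lower_bound: "sublinear p \<Longrightarrow> - p (- x) \<le> p x"
  using sublinear_add[of p x "- x"] sublinear_zero[of p] by simp

lemma sublinearI:
  assumes add: "\<And>x y. p (x + y) \<le> p x + p y"
    and zero: "p 0 = 0"
    and scale: "\<And>c x. c > 0 \<Longrightarrow> p (c *\<^sub>R x) \<le> c * p x"
  shows "sublinear p"
  unfolding sublinear_def
proof (intro conjI allI impI add)
  fix c :: real and x
  assume "0 \<le> c"
  show "p (c *\<^sub>R x) = c * p x"
  proof (cases "c = 0")
    case False
    with \<open>0 \<le> c\<close> have c: "0 < c"
      by simp
    \<comment> \<open>The reverse inequality is the assumed one for \<open>inverse c\<close>.\<close>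
    have "p x \<le> inverse c * p (c *\<^sub>R x)"
      using scale[of "inverse c" "c *\<^sub>R x"] c by simp
    then have "c * p x \<le> p (c *\<^sub>R x)"
      using c by (simp add: field_simps)
    with scale[OF c, of x] show ?thesis
      by simp
  qed (simp add: zero)
qed

text \<open>
  The function \<open>q\<close> is the infimum of \<open>p (x + t y) - t p y\<close> over \<open>t \<ge> 0\<close>. If \<open>q = p\<close>, then
  the second estimate is the superadditivity \<open>p x + p y \<le> p (x + y)\<close>; at \<open>x = - y\<close> it gives
  \<open>q (- y) \<le> - p y\<close>.
\<close>

lemma sublinear_pull_down:
  assumes p: "sublinear p"
  obtains q where "sublinear q" "\<And>x. q x \<le> p x" "\<And>x. q x \<le> p (x + y) - p y"
proof
  define g where "g x t = p (x + t *\<^sub>R y) - t * p y" for x t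
  define q where "q x = (INF t\<in>{0..}. g x t)" for x
  have bdd: "bdd_below (g x ` {0..})" for x
  proof (rule bdd_belowI2)
    fix t :: real
    assume "t \<in> {0..}"
    then show "- p (- x) \<le> g x t"
      using sublinear_add[OF p, of "x + t *\<^sub>R y" "- x"] sublinear_scaleR[OF p, of t y]
      by (simp add: g_def)
  qed
  have lower: "q x \<le> g x t" if "t \<ge> 0" for x t
    unfolding q_def using that by (intro cINF_lower bdd) auto
  have greatest: "m \<le> q x" if "\<And>t. t \<ge> 0 \<Longrightarrow> m \<le> g x t" for m x
    unfolding q_def using that by (intro cINF_greatest) auto
  show "q x \<le> p x" for x
    using lower[of 0 x] by (simp add: g_def)
  show "q x \<le> p (x + y) - p y" for x
    using lower[of 1 x] by (simp add: g_def)
  show "sublinear q"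
  proof (rule sublinearI)
    fix x x'
    have "q (x + x') - g x s \<le> q x'" if s: "s \<ge> 0" for s
    proof (rule greatest)
      fix t :: real
      assume t: "t \<ge> 0"
      have "q (x + x') \<le> g (x + x') (s + t)"
        using s t by (intro lower) simp
      also have "\<dots> \<le> g x s + g x' t"
        using sublinear_add[OF p, of "x + s *\<^sub>R y" "x' + t *\<^sub>R y"]
        by (simp add: g_def algebra_simps)
      finally show "q (x + x') - g x s \<le> g x' t"
        by simp
    qed
    then have "q (x + x') - q x' \<le> q x"
      by (intro greatest) (simp add: algebra_simps)
    then show "q (x + x') \<le> q x + q x'"
      by simp
  next
    show "q 0 = 0"
    proof (rule antisym)
      show "q 0 \<le> 0"
        using lower[of 0 0] sublinear_zero[OF p] by (simp add: g_def)
      show "0 \<le> q 0"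
        by (rule greatest) (simp add: g_def sublinear_scaleR[OF p])
    qed
  next
    fix c :: real and x
    assume c: "c > 0"
    have "q (c *\<^sub>R x) / c \<le> q x"
    proof (rule greatest)
      fix t :: real
      assume t: "t \<ge> 0"
      have "q (c *\<^sub>R x) \<le> g (c *\<^sub>R x) (c * t)"
        using c t by (intro lower) simp
      also have "\<dots> = c * g x t"
        using sublinear_scaleR[OF p, of c "x + t *\<^sub>R y"] c by (simp add: g_def algebra_simps)
      finally show "q (c *\<^sub>R x) / c \<le> g x t"
        using c by (simp add: field_simps)
    qed
    then show "q (c *\<^sub>R x) \<le> c * q x"
      using c by (simp add: field_simps)
  qed
qed

text \<open>
  Zorn's lemma applies to the functions below \<open>p\<close>: the pointwise infimum of a chain is finite since
  every sublinear \<open>q \<le> p\<close> satisfies \<open>q x \<ge> - q (- x) \<ge> - p (- x)\<close>.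
\<close>

lemma minimal_sublinear_below:
  assumes p: "sublinear p"
  obtains m where "sublinear m" "m \<le> p" "\<And>q. sublinear q \<Longrightarrow> q \<le> m \<Longrightarrow> q = m"
proof -
  define A where "A = {q. sublinear q \<and> q \<le> p}"
  have "\<exists>m\<in>A. \<forall>q\<in>A. q \<le> m \<longrightarrow> q = m"
  proof (rule predicate_Zorn[where P = "\<lambda>x y. y \<le> x"])
    show "partial_order_on A (relation_of (\<lambda>x y. y \<le> x) A)"
      by (rule partial_order_on_relation_ofI) auto
  next
    fix C
    assume chain: "C \<in> Chains (relation_of (\<lambda>x y. y \<le> x) A)"
    then have CA: "C \<subseteq> A"
      unfolding Chains_def relation_of_def by auto
    have total: "q \<le> r \<or> r \<le> q" if "q \<in> C" "r \<in> C" for q r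
      using chain that unfolding Chains_def relation_of_def by auto
    have sub: "sublinear q" and le: "q x \<le> p x" if "q \<in> C" for q x
      using CA that by (auto simp: A_def le_fun_def)
    show "\<exists>u\<in>A. \<forall>q\<in>C. u \<le> q"
    proof (cases "C = {}")
      case True
      then show ?thesis
        using p by (auto simp: A_def)
    next
      case False
      define u where "u x = (INF q\<in>C. q x)" for x
      have bdd: "bdd_below ((\<lambda>q. q x) ` C)" for x
      proof (rule bdd_belowI2)
        fix q
        assume "q \<in> C"
        then show "- p (- x) \<le> q x"
          using sublinear_lower_bound[OF sub, of q x] le[of q "- x"] by simp
      qed
      have lower: "u x \<le> q x" if "q \<in> C" for q x
        unfolding u_def using that by (intro cINF_lower bdd)
      have greatest: "m \<le> u x" if "\<And>q. q \<in> C \<Longrightarrow> m \<le> q x" for m x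
        unfolding u_def using that False by (intro cINF_greatest)
      have "sublinear u"
      proof (rule sublinearI)
        fix x y
        have "u (x + y) - q x \<le> u y" if q: "q \<in> C" for q
        proof (rule greatest)
          fix r
          assume r: "r \<in> C"
          \<comment> \<open>The smaller of two members of the chain bounds both summands.\<close>
          have "u (x + y) \<le> q x + r y"
          proof (cases "q \<le> r")
            case True
            then show ?thesis
              using lower[OF q, of "x + y"] sublinear_add[OF sub[OF q], of x y]
              by (auto simp: le_fun_def intro: order_trans add_left_mono)
          next
            case False
            with total[OF q r] have "r x \<le> q x"
              by (auto simp: le_fun_def)
            then show ?thesis
              using lower[OF r, of "x + y"] sublinear_add[OF sub[OF r], of x y] by linarith
          qed
          then show "u (x + y) - q x \<le> r y"
            by simp
        qed
        then have "u (x + y) - u y \<le> u x"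
          by (intro greatest) (simp add: algebra_simps)
        then show "u (x + y) \<le> u x + u y"
          by simp
      next
        show "u 0 = 0"
          using False sub by (simp add: u_def sublinear_zero cong: INF_cong_simp)
      next
        fix c :: real and x
        assume c: "c > 0"
        have "u (c *\<^sub>R x) / c \<le> u x"
        proof (rule greatest)
          fix q
          assume q: "q \<in> C"
          show "u (c *\<^sub>R x) / c \<le> q x"
            using lower[OF q, of "c *\<^sub>R x"] sublinear_scaleR[OF sub[OF q], of c x] c
            by (simp add: field_simps)
        qed
        then show "u (c *\<^sub>R x) \<le> c * u x"
          using c by (simp add: field_simps)
      qed
      moreover have "u \<le> p"
        using False lower le unfolding le_fun_def by (meson all_not_in_conv order_trans)
      ultimately show ?thesis
        using lower by (auto simp: A_def le_fun_def)
    qed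
  qed
  then obtain m where m: "m \<in> A" "\<And>q. q \<in> A \<Longrightarrow> q \<le> m \<Longrightarrow> q = m"
    by blast
  show ?thesis
  proof
    show "sublinear m" "m \<le> p"
      using m(1) by (auto simp: A_def)
    show "q = m" if "sublinear q" "q \<le> m" for q
      using m that \<open>m \<le> p\<close> by (auto simp: A_def)
  qed
qed

text \<open>
  A minimal \<open>m\<close> coincides with each of its modifications from \<open>sublinear_pull_down\<close>, which turns
  subadditivity into additivity.
\<close>

lemma minimal_sublinear_linear:
  assumes m: "sublinear m" and min: "\<And>q. sublinear q \<Longrightarrow> q \<le> m \<Longrightarrow> q = m"
  shows "linear m"
proof
  show add: "m (x + y) = m x + m y" for x y
  proof -
    obtain q where q: "sublinear q" "\<And>x. q x \<le> m x" "\<And>x. q x \<le> m (x + y) - m y"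
      using sublinear_pull_down[OF m, of y] by blast
    then have "q = m"
      by (intro min) (auto simp: le_fun_def)
    with q(3)[of x] sublinear_add[OF m, of x y] show ?thesis
      by simp
  qed
  have neg: "m (- x) = - m x" for x
    using add[of x "- x"] sublinear_zero[OF m] by simp
  show "m (c *\<^sub>R x) = c *\<^sub>R m x" for c x
    using sublinear_scaleR[OF m, of "\<bar>c\<bar>" x] neg[of "\<bar>c\<bar> *\<^sub>R x"]
    by (cases "c \<ge> 0") simp_all
qed

text \<open>
  A minimal sublinear function below the norm is a functional of norm at most \<open>1\<close>. To reach the
  value \<open>\<parallel>v\<parallel>\<close> at \<open>v\<close>, the norm is first replaced by a smaller sublinear function that is at most
  \<open>- \<parallel>v\<parallel>\<close> at \<open>- v\<close>.
\<close>

lemma exists_norming_functional: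
  fixes v :: "'a::real_normed_vector"
  obtains f :: "'a \<Rightarrow> real" where "bounded_linear f" "f v = norm v"
proof -
  have "sublinear (norm :: 'a \<Rightarrow> real)"
    by (simp add: sublinear_def norm_triangle_ineq)
  then obtain r :: "'a \<Rightarrow> real" where
    r: "sublinear r" "\<And>x. r x \<le> norm x" "\<And>x. r x \<le> norm (x + v) - norm v"
    using sublinear_pull_down[of norm v] by blast
  obtain f where f: "sublinear f" "f \<le> r" "\<And>q. sublinear q \<Longrightarrow> q \<le> f \<Longrightarrow> q = f"
    using minimal_sublinear_below[OF r(1)] by blast
  then have lin: "linear f"
    by (intro minimal_sublinear_linear)
  have le: "f x \<le> norm x" for x
    using f(2) r(2) by (auto simp: le_fun_def intro: order_trans)
  have abs: "\<bar>f x\<bar> \<le> norm x" for x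
    using le[of x] le[of "- x"] linear_neg[OF lin, of x] by simp
  show ?thesis
  proof
    show "bounded_linear f"
      using abs by (intro bounded_linear.intro lin)
        (auto simp: bounded_linear_axioms_def intro!: exI[of _ 1])
    have "f (- v) \<le> - norm v"
      using f(2) r(3)[of "- v"] by (auto simp: le_fun_def intro: order_trans)
    then show "f v = norm v"
      using le[of v] linear_neg[OF lin, of v] by simp
  qed
qed

section \<open>Bounded functionals over the scalar field\<close>

text \<open>
  The defect \<open>h r = \<phi> r - r\<close> is additive, vanishes at the integers and satisfies
  \<open>\<bar>h r\<bar> \<le> 2 \<bar>r\<bar>\<close>. Hence \<open>k h(r) = h(k r)\<close> depends on the fractional part of \<open>k r\<close> only and stays
  bounded by \<open>2\<close> for all \<open>k\<close>.
\<close>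

lemma additive_isometry_of_real:
  fixes \<phi> :: "'a::real_normed_field \<Rightarrow> 'b::real_normed_field"
  assumes add: "\<And>a b. \<phi> (a + b) = \<phi> a + \<phi> b"
    and mult: "\<And>a b. \<phi> (a * b) = \<phi> a * \<phi> b"
    and iso: "\<And>a. norm (\<phi> a) = norm a"
  shows "\<phi> (of_real r) = of_real r"
proof -
  define h :: "real \<Rightarrow> 'b" where "h s = \<phi> (of_real s) - of_real s" for s
  have hadd: "h (s + t) = h s + h t" for s t
    by (simp add: h_def add)
  then interpret h: additive h
    by (rule Modules.additive.intro)
  have "\<phi> 1 \<noteq> 0"
    using iso[of 1] by auto
  then have "\<phi> 1 = 1"
    using mult[of 1 1] by simp
  then have h1: "h 1 = 0"
    by (simp add: h_def)
  have bound: "norm (h s) \<le> 2 * \<bar>s\<bar>" for s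
    using norm_triangle_ineq4[of "\<phi> (of_real s)" "of_real s"] by (simp add: h_def iso)
  have mult_nat: "h (of_nat k * s) = of_nat k * h s" for k s
    by (induction k) (simp_all add: h.zero h.add algebra_simps)
  have nat: "h (of_nat k) = 0" for k
    using mult_nat[of k 1] h1 by simp
  have int: "h (of_int k) = 0" for k
    using nat[of "nat \<bar>k\<bar>"] h.minus[of "of_int k"] by (cases "k \<ge> 0") simp_all
  have "real k * norm (h r) \<le> 2" for k
  proof -
    have "of_nat k * h r = h (frac (real k * r))"
      using h.diff[of "real k * r" "of_int \<lfloor>real k * r\<rfloor>"] by (simp add: mult_nat int frac_def)
    then have "real k * norm (h r) = norm (h (frac (real k * r)))"
      by (metis norm_mult norm_of_nat)
    also have "\<dots> \<le> 2 * \<bar>frac (real k * r)\<bar>"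
      by (rule bound)
    also have "\<dots> \<le> 2"
      using frac_lt_1[of "real k * r"] by simp
    finally show ?thesis .
  qed
  then have "norm (h r) \<le> 0"
    by (meson ex_less_of_nat_mult linorder_not_le)
  then show ?thesis
    by (simp add: h_def)
qed

text \<open>
  Linearity over the scalars thus amounts to real linearity, together with compatibility with \<open>i\<close> in
  the complex case.
\<close>

lemma real_or_complex_cases:
  obtains (real) "\<And>c::'k::real_or_complex. \<exists>r. c = of_real r"
    | (complex) i :: "'k::real_or_complex" where "i * i = - 1"
        "\<And>c::'k. \<exists>a b. c = of_real a + of_real b * i"
proof -
  consider \<phi> :: "'k \<Rightarrow> real" where "bij \<phi>" "\<And>a b. \<phi> (a + b) = \<phi> a + \<phi> b"
      "\<And>a b. \<phi> (a * b) = \<phi> a * \<phi> b" "\<And>a. norm (\<phi> a) = norm a"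
    | \<phi> :: "'k \<Rightarrow> complex" where "bij \<phi>" "\<And>a b. \<phi> (a + b) = \<phi> a + \<phi> b"
      "\<And>a b. \<phi> (a * b) = \<phi> a * \<phi> b" "\<And>a. norm (\<phi> a) = norm a"
    using real_or_complex[where 'a = 'k] by blast
  then show ?thesis
  proof cases
    case (1 \<phi>)
    have "c = of_real (\<phi> c)" for c
      using additive_isometry_of_real[OF 1(2-4), of "\<phi> c"] bij_is_inj[OF 1(1)]
      by (simp add: inj_eq)
    then show ?thesis
      using real by blast
  next
    case (2 \<phi>)
    note re = additive_isometry_of_real[OF 2(2-4)]
    obtain i where i: "\<phi> i = \<i>"
      using 2(1) by (metis bij_pointE)
    have "c = of_real (Re (\<phi> c)) + of_real (Im (\<phi> c)) * i" for c
    proof -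
      have "\<phi> c = \<phi> (of_real (Re (\<phi> c)) + of_real (Im (\<phi> c)) * i)"
        by (simp add: 2(2,3) re i complex_eq mult.commute)
      then show ?thesis
        using bij_is_inj[OF 2(1)] by (simp add: inj_eq)
    qed
    moreover have "i * i = - 1"
    proof -
      have "\<phi> (i * i) = \<phi> (- 1)"
        using re[of "- 1"] by (simp add: 2(3) i)
      then show ?thesis
        using bij_is_inj[OF 2(1)] by (simp add: inj_eq)
    qed
    ultimately show ?thesis
      using complex by blast
  qed
qed

context banach_space_over
begin

sublocale endo: vector_space_pair scale scale ..

lemma bounded_linear_scale: "bounded_linear (scale c)"
proof (rule bounded_linear_intro)
  show "scale c (r *\<^sub>R x) = r *\<^sub>R scale c x" for r x
    by (simp flip: scale_of_real add: mult.commute)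
  show "norm (scale c x) \<le> norm x * norm c" for x
    by (simp add: norm_scale mult.commute)
qed (rule scale_right_distrib)

definition bounded_functionals :: "('a \<Rightarrow> 'k) set" where
  "bounded_functionals = {f. bounded_linear f \<and> (\<forall>c x. f (scale c x) = c * f x)}"

lemma
  assumes "f \<in> bounded_functionals"
  shows functional_bounded_linear: "bounded_linear f"
    and functional_scale: "f (scale c x) = c * f x"
    and functional_add: "f (x + y) = f x + f y"
    and functional_diff: "f (x - y) = f x - f y"
    and functional_zero: "f 0 = 0"
    and functional_sum: "f (sum u A) = (\<Sum>a\<in>A. f (u a))"
proof -
  show f: "bounded_linear f" and "f (scale c x) = c * f x"
    using assms unfolding bounded_functionals_def by blast+
  interpret bounded_linear f
    by (rule f)
  show "f (x + y) = f x + f y" "f (x - y) = f x - f y" "f 0 = 0" "f (sum u A) = (\<Sum>a\<in>A. f (u a))"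
    by (rule add diff zero sum)+
qed

text \<open>
  Over complex scalars, a real-linear functional \<open>g\<close> is the real part of the linear functional
  \<open>x \<mapsto> g x - i g (i x)\<close>.
\<close>

lemma exists_functional_nonzero:
  assumes "v \<noteq> 0"
  obtains f where "f \<in> bounded_functionals" "f v \<noteq> 0"
proof -
  obtain g :: "'a \<Rightarrow> real" where g: "bounded_linear g" "g v = norm v"
    using exists_norming_functional .
  interpret g: bounded_linear g
    by (rule g)
  show ?thesis
  proof (cases rule: real_or_complex_cases[where 'k = 'k])
    case real
    let ?f = "\<lambda>x. of_real (g x) :: 'k"
    have "?f (scale c x) = c * ?f x" for c x
    proof -
      obtain r where "c = of_real r"
        using real by blast
      then show ?thesis
        by (simp add: scale_of_real g.scaleR)
    qed
    moreover have "bounded_linear ?f"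
      by (intro bounded_linear_compose[OF bounded_linear_of_real] g)
    ultimately show ?thesis
      using that[of ?f] g(2) assms by (simp add: bounded_functionals_def)
  next
    case (complex i)
    let ?f = "\<lambda>x. of_real (g x) - i * of_real (g (scale i x)) :: 'k"
    have "?f (scale c x) = c * ?f x" for c x
    proof -
      obtain a b where c: "c = of_real a + of_real b * i"
        using complex(2) by blast
      have scale_c: "scale c y = a *\<^sub>R y + b *\<^sub>R scale i y" for y
        by (simp add: c scale_left_distrib scale_of_real flip: scale_scale)
      then have 1: "g (scale c x) = a * g x + b * g (scale i x)"
        by (simp only: g.add g.scaleR real_scaleR_def)
      have 2: "g (scale i (scale c x)) = a * g (scale i x) - b * g x"
      proof -
        have "scale i (scale c x) = scale c (scale i x)"
          by (simp add: mult.commute)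
        also have "\<dots> = a *\<^sub>R scale i x - b *\<^sub>R x"
          using scale_c[of "scale i x"] by (simp add: complex(1))
        finally show ?thesis
          by (simp only: g.diff g.scaleR real_scaleR_def)
      qed
      have "of_real (a * u + b * w) - i * of_real (a * w - b * u)
          = (of_real a + of_real b * i) * (of_real u - i * of_real w)" for u w
      proof -
        have "(of_real a + of_real b * i) * (of_real u - i * of_real w)
            = of_real a * of_real u - of_real b * of_real w * (i * i)
              - i * (of_real a * of_real w - of_real b * of_real u)"
          by (simp only: algebra_simps)
        then show ?thesis
          by (simp add: complex(1))
      qed
      then show ?thesis
        unfolding 1 2 by (simp only: c)
    qed
    moreover have "bounded_linear ?f"
      by (intro bounded_linear_sub bounded_linear_compose[OF bounded_linear_mult_right]
          bounded_linear_compose[OF bounded_linear_of_real]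
          bounded_linear_compose[OF g(1) bounded_linear_scale] g)
    moreover have "?f v \<noteq> 0"
    proof
      \<comment> \<open>Squaring \<open>g v = i g (i v)\<close> equates a positive real with a nonpositive one.\<close>
      assume "?f v = 0"
      then have eq: "of_real (g v) = i * of_real (g (scale i v))"
        by simp
      have "of_real ((g v)\<^sup>2) = (i * of_real (g (scale i v))) * (i * of_real (g (scale i v)) :: 'k)"
        by (simp add: power2_eq_square flip: eq)
      also have "\<dots> = (i * i) * of_real ((g (scale i v))\<^sup>2)"
        by (simp add: power2_eq_square mult_ac)
      also have "\<dots> = of_real (- (g (scale i v))\<^sup>2)"
        by (simp add: complex(1))
      finally have "(g v)\<^sup>2 = - (g (scale i v))\<^sup>2"
        by (simp only: of_real_eq_iff)
      moreover have "(g v)\<^sup>2 > 0"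
        using assms by (simp add: g(2))
      ultimately show False
        using zero_le_power2[of "g (scale i v)"] by linarith
    qed
    ultimately show ?thesis
      using that[of ?f] by (simp add: bounded_functionals_def)
  qed
qed

lemma functional_times:
  "f \<in> bounded_functionals \<Longrightarrow> (\<lambda>x. c * f x) \<in> bounded_functionals"
  unfolding bounded_functionals_def
  using bounded_linear_compose[OF bounded_linear_mult_right, of f c] by (simp add: mult.left_commute)

lemma functional_plus:
  "f \<in> bounded_functionals \<Longrightarrow> g \<in> bounded_functionals \<Longrightarrow> (\<lambda>x. f x + g x) \<in> bounded_functionals"
  unfolding bounded_functionals_def by (simp add: bounded_linear_add distrib_left)

lemma functional_minus:
  "f \<in> bounded_functionals \<Longrightarrow> g \<in> bounded_functionals \<Longrightarrow> (\<lambda>x. f x - g x) \<in> bounded_functionals"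
  unfolding bounded_functionals_def by (simp add: bounded_linear_sub right_diff_distrib)

lemma functional_compose:
  "f \<in> bounded_functionals \<Longrightarrow> Q \<in> bounded_operators \<Longrightarrow> (\<lambda>x. f (blinfun_apply Q x)) \<in> bounded_functionals"
  unfolding bounded_functionals_def bounded_operators_def
  by (simp add: bounded_linear_compose[OF _ blinfun.bounded_linear_right])

definition finite_rank :: "'b set \<Rightarrow> ('b \<Rightarrow> 'a \<Rightarrow> 'k) \<Rightarrow> ('b \<Rightarrow> 'a) \<Rightarrow> 'a \<Rightarrow>\<^sub>L 'a" where
  "finite_rank B f e = Blinfun (\<lambda>x. \<Sum>b\<in>B. scale (f b x) (e b))"

lemma finite_rank_apply:
  assumes "\<And>b. b \<in> B \<Longrightarrow> f b \<in> bounded_functionals"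
  shows "blinfun_apply (finite_rank B f e) x = (\<Sum>b\<in>B. scale (f b x) (e b))"
proof -
  have "bounded_linear (\<lambda>x. scale (f b x) (e b))" if "b \<in> B" for b
  proof -
    note fb = assms[OF that]
    obtain K where K: "\<And>x. norm (f b x) \<le> norm x * K"
      using bounded_linear.bounded[OF functional_bounded_linear[OF fb]] by blast
    show ?thesis
    proof (rule bounded_linear_intro)
      show "scale (f b (x + y)) (e b) = scale (f b x) (e b) + scale (f b y) (e b)" for x y
        by (simp add: functional_add[OF fb] scale_left_distrib)
      show "scale (f b (r *\<^sub>R x)) (e b) = r *\<^sub>R scale (f b x) (e b)" for r x
        by (simp add: functional_scale[OF fb] flip: scale_of_real)
      show "norm (scale (f b x) (e b)) \<le> norm x * (K * norm (e b))" for x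
        using mult_right_mono[OF K[of x], of "norm (e b)"] by (simp add: norm_scale mult.assoc)
    qed
  qed
  then have "bounded_linear (\<lambda>x. \<Sum>b\<in>B. scale (f b x) (e b))"
    by (intro bounded_linear_sum)
  then show ?thesis
    by (simp add: finite_rank_def bounded_linear_Blinfun_apply)
qed

lemma finite_rank_bounded_operator:
  assumes "\<And>b. b \<in> B \<Longrightarrow> f b \<in> bounded_functionals"
  shows "finite_rank B f e \<in> bounded_operators"
proof -
  have eq: "blinfun_apply (finite_rank B f e) y = (\<Sum>b\<in>B. scale (f b y) (e b))" for y
    using assms by (rule finite_rank_apply)
  have "blinfun_apply (finite_rank B f e) (scale c x) = scale c (blinfun_apply (finite_rank B f e) x)"
    for c x
    unfolding eq scale_sum_right
    by (intro sum.cong) (simp_all add: functional_scale assms)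
  then show ?thesis
    by (simp add: bounded_operators_def)
qed

definition biorthogonal :: "'b set \<Rightarrow> ('b \<Rightarrow> 'a \<Rightarrow> 'k) \<Rightarrow> ('b \<Rightarrow> 'a) \<Rightarrow> bool" where
  "biorthogonal B f e \<longleftrightarrow> (\<forall>b\<in>B. f b \<in> bounded_functionals \<and>
     (\<forall>c\<in>B. f b (e c) = (if b = c then 1 else 0)))"

lemma
  assumes "biorthogonal B f e" "b \<in> B"
  shows biorthogonal_functional: "f b \<in> bounded_functionals"
    and biorthogonal_apply: "c \<in> B \<Longrightarrow> f b (e c) = (if b = c then 1 else 0)"
  using assms unfolding biorthogonal_def by blast+

text \<open>
  In the induction step, the functionals dual to \<open>B\<close> define a projection onto the span of \<open>B\<close>.
  Since this projection moves the new vector \<open>a\<close>, some functional that vanishes on \<open>B\<close> takes the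
  value \<open>1\<close> at \<open>a\<close>; subtracting multiples of it makes the old functionals vanish at \<open>a\<close>.
\<close>

lemma exists_dual_functionals:
  assumes "finite B" "independent B"
  obtains f where "biorthogonal B f id"
proof -
  have "\<exists>f. \<forall>b\<in>B. f b \<in> bounded_functionals \<and> (\<forall>c\<in>B. f b c = (if b = c then 1 else 0))"
    using assms
  proof (induction B)
    case empty
    then show ?case
      by simp
  next
    case (insert a B)
    then have a: "a \<notin> span B" and "independent B"
      by (simp_all add: independent_insert)
    with insert.IH obtain f where f: "\<And>b. b \<in> B \<Longrightarrow> f b \<in> bounded_functionals"
      and dual: "\<And>b c. b \<in> B \<Longrightarrow> c \<in> B \<Longrightarrow> f b c = (if b = c then 1 else 0)"
      by blast
    let ?P = "finite_rank B f id"
    have P: "?P x = (\<Sum>b\<in>B. scale (f b x) b)" for x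
      by (simp add: finite_rank_apply f)
    then have "?P a \<in> span B"
      by (simp add: span_sum span_scale span_base)
    with a have "a - ?P a \<noteq> 0"
      by auto
    then obtain h where h: "h \<in> bounded_functionals" "h (a - ?P a) \<noteq> 0"
      using exists_functional_nonzero by blast
    define g where "g x = inverse (h (a - ?P a)) * (h x - h (?P x))" for x
    have g: "g \<in> bounded_functionals"
      unfolding g_def
      using h(1) f by (intro functional_times functional_minus functional_compose[OF _ finite_rank_bounded_operator])
    have "?P b = b" if "b \<in> B" for b
      using that \<open>finite B\<close> by (simp add: P dual if_distrib[of "\<lambda>c. scale c _"] cong: if_cong)
    then have gB: "g b = 0" if "b \<in> B" for b
      using that by (simp add: g_def)
    have ga: "g a = 1"
      using h by (simp add: g_def functional_diff)
    let ?f = "\<lambda>b. if b = a then g else (\<lambda>x. f b x - f b a * g x)"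
    have "?f b \<in> bounded_functionals" if "b \<in> insert a B" for b
      using that g f by (auto intro!: functional_minus functional_times)
    moreover have "?f b c = (if b = c then 1 else 0)" if "b \<in> insert a B" "c \<in> insert a B" for b c
      using that \<open>a \<notin> B\<close> by (auto simp: ga gB dual)
    ultimately have "\<forall>b\<in>insert a B. ?f b \<in> bounded_functionals
        \<and> (\<forall>c\<in>insert a B. ?f b c = (if b = c then 1 else 0))"
      by blast
    then show ?case
      by (rule exI[of _ ?f])
  qed
  then obtain f where
    f: "\<forall>b\<in>B. f b \<in> bounded_functionals \<and> (\<forall>c\<in>B. f b c = (if b = c then 1 else 0))" ..
  show ?thesis
    by (rule that[of f]) (use f in \<open>simp add: biorthogonal_def\<close>)
qed

section \<open>Dimension of subspaces\<close>

text \<open>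
  This includes subspaces without a finite basis, where both dimensions are \<open>0\<close>, because the image
  of a basis is a basis.
\<close>

lemma dim_linear_image:
  assumes f: "Vector_Spaces.linear scale scale f" and V: "subspace V" and inj: "inj_on f V"
  shows "dim (f ` V) = dim V"
proof -
  obtain B where B: "B \<subseteq> V" "independent B" "V \<subseteq> span B" "card B = dim V"
    using basis_exists by blast
  have span: "span B = V"
    using B V span_minimal by blast
  have "independent (f ` B)"
    using endo.linear_independent_injective_image[OF f B(2)] inj span by simp
  moreover have "span (f ` B) = f ` V"
    using endo.linear_span_image[OF f] span by simp
  ultimately have "dim (f ` V) = card (f ` B)"
    using dim_span_eq_card_independent by metis
  also have "\<dots> = card B"
    using inj B(1) by (intro card_image) (rule inj_on_subset)
  finally show ?thesis
    using B(4) by simp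
qed

text \<open>
  An infinite dimensional subspace has \<open>dim V = 0\<close>, so a positive dimension guarantees a finite
  basis.
\<close>

lemma finite_basis:
  assumes "subspace V" "dim V = n" "n \<ge> 1"
  obtains B where "finite B" "independent B" "span B = V" "card B = n"
proof -
  obtain B where B: "B \<subseteq> V" "independent B" "V \<subseteq> span B" "card B = dim V"
    using basis_exists by blast
  show ?thesis
  proof
    show "finite B" "card B = n"
      using B(4) assms card_ge_0_finite[of B] by simp_all
    show "independent B" "span B = V"
      using B assms(1) span_minimal by blast+
  qed
qed

lemma dim_mono_finite:
  assumes "V \<subseteq> W" "subspace W" "dim W \<ge> 1"
  shows "dim V \<le> dim W"
proof -
  obtain B where "finite B" "span B = W" "card B = dim W"
    using finite_basis assms by metis
  then show ?thesis
    using dim_le_card[of V B] assms(1) by simp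
qed

lemma subspace_eq_if_dim_eq:
  assumes "V \<subseteq> W" "subspace V" "subspace W" "dim V = dim W" "dim V \<ge> 1"
  shows "V = W"
proof (rule ccontr)
  assume "V \<noteq> W"
  then obtain a where a: "a \<in> W" "a \<notin> V"
    using assms(1) by blast
  obtain B where B: "finite B" "independent B" "span B = V" "card B = dim V"
    using finite_basis[OF assms(2) refl assms(5)] .
  obtain C where C: "finite C" "span C = W" "card C = dim W"
    using finite_basis[OF assms(3) refl] assms(4,5) by metis
  have "independent (insert a B)"
    using a B by (intro independent_insertI) auto
  moreover have "insert a B \<subseteq> span C"
    using a(1) assms(1) B(3) C(2) span_superset[of B] by auto
  ultimately have "card (insert a B) \<le> card C"
    using independent_span_bound[OF C(1)] by blast
  moreover have "a \<notin> B"
    using a(2) B(3) span_base by blast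
  ultimately show False
    using B C assms(4) by simp
qed

section \<open>Ranges and kernels of idempotents\<close>

lemma operator_linear:
  "Q \<in> bounded_operators \<Longrightarrow> Vector_Spaces.linear scale scale (blinfun_apply Q)"
  by (simp add: Vector_Spaces.linear_iff bounded_operators_def blinfun.add_right vector_space_axioms)

lemma idempotent_operator: "Q \<in> idempotents \<Longrightarrow> Q \<in> bounded_operators"
  and idempotent_apply: "Q \<in> idempotents \<Longrightarrow> blinfun_apply Q (blinfun_apply Q x) = blinfun_apply Q x"
  by (auto simp: idempotents_def) (metis blinfun_apply_blinfun_compose)

lemma idempotent_range_iff:
  assumes "Q \<in> idempotents"
  shows "x \<in> range (blinfun_apply Q) \<longleftrightarrow> blinfun_apply Q x = x"
proof
  assume "x \<in> range (blinfun_apply Q)"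
  then show "blinfun_apply Q x = x"
    by (auto simp: idempotent_apply[OF assms])
qed (rule range_eqI, rule sym)

lemma subspace_range_operator: "Q \<in> bounded_operators \<Longrightarrow> subspace (range (blinfun_apply Q))"
  by (intro endo.linear_subspace_image operator_linear subspace_UNIV)

lemma subspace_kernel: "Q \<in> bounded_operators \<Longrightarrow> subspace {x. blinfun_apply Q x = 0}"
  by (intro endo.linear_subspace_kernel operator_linear)

lemma closed_kernel: "closed {x. blinfun_apply Q x = 0}"
  by (intro closed_Collect_eq continuous_intros)

lemma closed_range_idempotent:
  assumes "Q \<in> idempotents"
  shows "closed (range (blinfun_apply Q))"
proof -
  have "range (blinfun_apply Q) = {x. blinfun_apply Q x = x}"
    using idempotent_range_iff[OF assms] by blast
  moreover have "closed {x. blinfun_apply Q x = x}"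
    by (intro closed_Collect_eq continuous_intros)
  ultimately show ?thesis
    by simp
qed

lemma range_kernel_complementary:
  assumes Q: "Q \<in> idempotents"
  shows "range (blinfun_apply Q) \<in> closed_complements {x. blinfun_apply Q x = 0}"
    and "{x. blinfun_apply Q x = 0} \<in> closed_complements (range (blinfun_apply Q))"
proof -
  have Qop: "Q \<in> bounded_operators"
    using Q by (rule idempotent_operator)
  have zero: "x = 0" if "x \<in> range (blinfun_apply Q)" "blinfun_apply Q x = 0" for x
    using that idempotent_range_iff[OF Q] by auto
  have int: "range (blinfun_apply Q) \<inter> {x. blinfun_apply Q x = 0} = {0}"
  proof
    show "range (blinfun_apply Q) \<inter> {x. blinfun_apply Q x = 0} \<subseteq> {0}"
      using zero by blast
    show "{0} \<subseteq> range (blinfun_apply Q) \<inter> {x. blinfun_apply Q x = 0}"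
      using subspace_0[OF subspace_range_operator[OF Qop]] by simp
  qed
  have split: "x = blinfun_apply Q x + (x - blinfun_apply Q x)"
    "blinfun_apply Q (x - blinfun_apply Q x) = 0" for x
    using idempotent_apply[OF Q] by (simp_all add: blinfun.diff_right)
  have sum: "{x + y |x y. x \<in> range (blinfun_apply Q) \<and> y \<in> {x. blinfun_apply Q x = 0}} = UNIV"
    using split by blast
  then have "{x + y |x y. x \<in> {x. blinfun_apply Q x = 0} \<and> y \<in> range (blinfun_apply Q)} = UNIV"
    by (subst add.commute) blast
  with int sum show "range (blinfun_apply Q) \<in> closed_complements {x. blinfun_apply Q x = 0}"
    and "{x. blinfun_apply Q x = 0} \<in> closed_complements (range (blinfun_apply Q))"
    by (simp_all add: closed_complements_def subspace_range_operator subspace_kernel Qop closed_kernel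
        closed_range_idempotent Q Int_commute)
qed

lemma range_kernel_in_grassmannian:
  assumes Q: "Q \<in> idempotents"
  shows "range (blinfun_apply Q) \<in> grassmannian"
    and "{x. blinfun_apply Q x = 0} \<in> grassmannian"
proof -
  have Qop: "Q \<in> bounded_operators" and "Q \<noteq> 0" and "Q \<noteq> id_blinfun"
    using Q by (auto simp: idempotents_def)
  obtain x where x: "blinfun_apply Q x \<noteq> 0"
    using \<open>Q \<noteq> 0\<close> by (metis blinfun_eqI zero_blinfun.rep_eq)
  obtain y where y: "blinfun_apply Q y \<noteq> y"
    using \<open>Q \<noteq> id_blinfun\<close> by (metis blinfun_eqI blinfun_apply_id_blinfun id_apply)
  have "y - blinfun_apply Q y \<in> {x. blinfun_apply Q x = 0}"
    using idempotent_apply[OF Q] by (simp add: blinfun.diff_right)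
  then have "{x. blinfun_apply Q x = 0} \<noteq> {0}"
    using y by force
  moreover have "{x. blinfun_apply Q x = 0} \<noteq> UNIV"
    using x by blast
  ultimately show "{x. blinfun_apply Q x = 0} \<in> grassmannian"
    using range_kernel_complementary(1)[OF Q]
    by (auto simp: grassmannian_def subspace_kernel Qop closed_kernel)
  have "range (blinfun_apply Q) \<noteq> {0}"
    using x by blast
  moreover have "range (blinfun_apply Q) \<noteq> UNIV"
    using y idempotent_range_iff[OF Q] by blast
  ultimately show "range (blinfun_apply Q) \<in> grassmannian"
    using range_kernel_complementary(2)[OF Q]
    by (auto simp: grassmannian_def subspace_range_operator Qop closed_range_idempotent Q)
qed

section \<open>Finite rank idempotents from biorthogonal systems\<close>

lemma biorthogonal_independent:
  assumes "finite B" and bi: "biorthogonal B f e"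
  shows "inj_on e B" "independent (e ` B)"
proof -
  note f = biorthogonal_functional[OF bi] and dual = biorthogonal_apply[OF bi]
  show inj: "inj_on e B"
  proof (rule inj_onI)
    fix b c
    assume "b \<in> B" "c \<in> B" "e b = e c"
    then show "b = c"
      using dual[of b b] dual[of b c] by (metis zero_neq_one)
  qed
  show "independent (e ` B)"
  proof (rule independent_if_scalars_zero)
    show "finite (e ` B)"
      using \<open>finite B\<close> by simp
    fix u x
    assume zero: "(\<Sum>x\<in>e ` B. scale (u x) x) = 0" and "x \<in> e ` B"
    then obtain b where b: "b \<in> B" "x = e b"
      by blast
    have "0 = f b (\<Sum>c\<in>B. scale (u (e c)) (e c))"
      using zero by (simp add: sum.reindex[OF inj] functional_zero[OF f[OF b(1)]])
    also have "\<dots> = (\<Sum>c\<in>B. u (e c) * (if b = c then 1 else 0))"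
      unfolding functional_sum[OF f[OF b(1)]] functional_scale[OF f[OF b(1)]]
      by (intro sum.cong) (simp_all add: dual b)
    also have "\<dots> = u x"
      using b \<open>finite B\<close> by (simp add: if_distrib[of "\<lambda>z. _ * z"] cong: if_cong)
    finally show "u x = 0"
      by simp
  qed
qed

lemma functional_finite_rank:
  assumes "finite B" and bi: "biorthogonal B f e" and "b \<in> B"
  shows "f b (blinfun_apply (finite_rank B f e) x) = f b x"
proof -
  note fb = biorthogonal_functional[OF bi \<open>b \<in> B\<close>]
  have "f b (blinfun_apply (finite_rank B f e) x) = f b (\<Sum>c\<in>B. scale (f c x) (e c))"
    using finite_rank_apply[of B f e] biorthogonal_functional[OF bi] by simp
  also have "\<dots> = (\<Sum>c\<in>B. f c x * (if b = c then 1 else 0))"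
    unfolding functional_sum[OF fb] functional_scale[OF fb]
    by (intro sum.cong) (simp_all add: biorthogonal_apply[OF bi] \<open>b \<in> B\<close>)
  also have "\<dots> = f b x"
    using assms by (simp add: if_distrib[of "\<lambda>z. _ * z"] cong: if_cong)
  finally show ?thesis .
qed

text \<open>
  The kernel of \<open>finite_rank B f e\<close> is the common kernel of the functionals \<open>f b\<close>, for every
  choice of biorthogonal vectors \<open>e\<close>. For \<open>d = e\<close> this is idempotence.
\<close>

lemma finite_rank_compose:
  assumes B: "finite B" and e: "biorthogonal B f e" and d: "biorthogonal B f d"
  shows "finite_rank B f e o\<^sub>L finite_rank B f d = finite_rank B f e"
proof (rule blinfun_eqI)
  fix x
  have "blinfun_apply (finite_rank B f e) y = (\<Sum>b\<in>B. scale (f b y) (e b))" for y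
    using biorthogonal_functional[OF e] by (rule finite_rank_apply)
  then show "blinfun_apply (finite_rank B f e o\<^sub>L finite_rank B f d) x
      = blinfun_apply (finite_rank B f e) x"
    by (simp add: functional_finite_rank[OF B d])
qed

lemma finite_rank_idempotent:
  assumes inf: "infinite_dimensional" and B: "finite B" "B \<noteq> {}" and bi: "biorthogonal B f e"
  shows "range (blinfun_apply (finite_rank B f e)) = span (e ` B)"
    and "finite_rank B f e \<in> idempotents_of_rank (card B)"
proof -
  let ?Q = "finite_rank B f e"
  note indep = biorthogonal_independent[OF B(1) bi]
  note f = biorthogonal_functional[OF bi] and dual = biorthogonal_apply[OF bi]
  have Q: "blinfun_apply ?Q x = (\<Sum>b\<in>B. scale (f b x) (e b))" for x
    using f by (rule finite_rank_apply)
  have Qop: "?Q \<in> bounded_operators"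
    using f by (rule finite_rank_bounded_operator)
  have Qe: "blinfun_apply ?Q (e c) = e c" if "c \<in> B" for c
  proof -
    have "blinfun_apply ?Q (e c) = (\<Sum>b\<in>B. scale (if b = c then 1 else 0) (e b))"
      unfolding Q by (intro sum.cong) (simp_all add: dual that)
    also have "\<dots> = e c"
      using B(1) that by (simp add: if_distrib[of "\<lambda>z. scale z _"] cong: if_cong)
    finally show ?thesis .
  qed
  have range: "range (blinfun_apply ?Q) = span (e ` B)"
  proof
    show "range (blinfun_apply ?Q) \<subseteq> span (e ` B)"
      unfolding Q by (intro image_subsetI span_sum span_scale span_base imageI)
    have "e ` B \<subseteq> range (blinfun_apply ?Q)"
      using Qe by (metis image_subsetI rangeI)
    then show "span (e ` B) \<subseteq> range (blinfun_apply ?Q)"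
      by (intro span_minimal subspace_range_operator Qop)
  qed
  then show "range (blinfun_apply ?Q) = span (e ` B)" .
  have "?Q \<noteq> 0"
  proof
    assume "?Q = 0"
    obtain b where b: "b \<in> B"
      using B(2) by blast
    then have "e b = 0"
      using Qe[OF b] \<open>?Q = 0\<close> by simp
    then show False
      using dual[OF b b] functional_zero[OF f[OF b]] by simp
  qed
  moreover have "?Q \<noteq> id_blinfun"
  proof
    assume "?Q = id_blinfun"
    then have "span (e ` B) = UNIV"
      using range by simp
    then show False
      using inf B(1) by (auto simp: infinite_dimensional_def)
  qed
  ultimately have "?Q \<in> idempotents"
    using Qop finite_rank_compose[OF B(1) bi bi] by (simp add: idempotents_def)
  moreover have "dim (range (blinfun_apply ?Q)) = card B"
    unfolding range dim_span_eq_card_independent[OF indep(2)] using indep(1) by (rule card_image)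
  ultimately show "?Q \<in> idempotents_of_rank (card B)"
    by (simp add: idempotents_of_rank_def)
qed

lemma exists_idempotent_onto:
  assumes "infinite_dimensional" "subspace V" "dim V = n" "n \<ge> 1"
  obtains Q where "Q \<in> idempotents_of_rank n" "range (blinfun_apply Q) = V"
proof -
  obtain B where B: "finite B" "independent B" "span B = V" "card B = n"
    using finite_basis[OF assms(2-4)] .
  obtain f where f: "biorthogonal B f id"
    using exists_dual_functionals[OF B(1,2)] .
  have "B \<noteq> {}"
    using B(4) assms(4) by auto
  then show ?thesis
    using that finite_rank_idempotent[OF assms(1) B(1) _ f] B(3,4) by simp
qed

section \<open>Connecting idempotents of equal rank\<close>

text \<open>
  The first alternative says that \<open>P\<close> and \<open>Q\<close> have the same range, the second that they have the
  same kernel. Either relation passes to each point \<open>S\<close> of the segment, and it excludes the values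
  \<open>0\<close> and \<open>I\<close>.
\<close>

lemma connected_component_segment:
  assumes P: "P \<in> idempotents" and Q: "Q \<in> idempotents"
    and compat: "P o\<^sub>L Q = Q \<and> Q o\<^sub>L P = P \<or> P o\<^sub>L Q = P \<and> Q o\<^sub>L P = Q"
  shows "connected_component idempotents P Q"
proof -
  have "(1 - u) *\<^sub>R P + u *\<^sub>R Q \<in> idempotents" for u
  proof -
    let ?S = "(1 - u) *\<^sub>R P + u *\<^sub>R Q"
    have PP: "P o\<^sub>L P = P" and QQ: "Q o\<^sub>L Q = Q" and "P \<noteq> 0" "P \<noteq> id_blinfun"
      using P Q by (auto simp: idempotents_def)
    note bilin = bounded_bilinear.add_left[OF bounded_bilinear_blinfun_compose]
      bounded_bilinear.add_right[OF bounded_bilinear_blinfun_compose]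
      bounded_bilinear.scaleR_left[OF bounded_bilinear_blinfun_compose]
      bounded_bilinear.scaleR_right[OF bounded_bilinear_blinfun_compose]
    have collapse: "(1 - u) *\<^sub>R R + u *\<^sub>R R = R" for R :: "'a \<Rightarrow>\<^sub>L 'a"
      by (simp flip: scaleR_left_distrib)
    have PS: "(P o\<^sub>L ?S = ?S \<and> ?S o\<^sub>L P = P) \<or> (P o\<^sub>L ?S = P \<and> ?S o\<^sub>L P = ?S)"
      using compat by (auto simp: bilin PP collapse)
    have QS: "(Q o\<^sub>L ?S = ?S \<and> P o\<^sub>L ?S = ?S) \<or> (Q o\<^sub>L ?S = Q \<and> P o\<^sub>L ?S = P)"
      using compat by (auto simp: bilin PP QQ collapse)
    have "?S o\<^sub>L ?S = (1 - u) *\<^sub>R (P o\<^sub>L ?S) + u *\<^sub>R (Q o\<^sub>L ?S)"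
      by (simp only: bilin(1,3))
    then have "?S o\<^sub>L ?S = ?S"
      using QS collapse[of ?S] by auto
    moreover have "?S \<in> bounded_operators"
    proof -
      have "r *\<^sub>R scale c x = scale c (r *\<^sub>R x)" for r c x
        using bounded_linear_scale by (simp add: linear_simps)
      then show ?thesis
        using idempotent_operator[OF P] idempotent_operator[OF Q]
        by (simp add: bounded_operators_def blinfun.add_left blinfun.scaleR_left scale_right_distrib)
    qed
    moreover have "?S \<noteq> 0"
    proof
      assume "?S = 0"
      then show False
        using PS \<open>P \<noteq> 0\<close> by auto
    qed
    moreover have "?S \<noteq> id_blinfun"
    proof
      assume "?S = id_blinfun"
      moreover have "P o\<^sub>L id_blinfun = P" "id_blinfun o\<^sub>L P = P"
        by (auto intro!: blinfun_eqI)
      ultimately show False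
        using PS \<open>P \<noteq> id_blinfun\<close> by auto
    qed
    ultimately show ?thesis
      by (simp add: idempotents_def)
  qed
  then have "closed_segment P Q \<subseteq> idempotents"
    by (auto simp: closed_segment_def)
  then show ?thesis
    by (auto intro: connected_componentI connected_segment)
qed

lemma connected_component_same_range:
  assumes P: "P \<in> idempotents" and Q: "Q \<in> idempotents"
    and "range (blinfun_apply P) = range (blinfun_apply Q)"
  shows "connected_component idempotents P Q"
proof -
  have "P o\<^sub>L Q = Q" "Q o\<^sub>L P = P"
    using idempotent_range_iff[OF P] idempotent_range_iff[OF Q] assms(3)
    by (metis blinfun_apply_blinfun_compose blinfun_eqI comp_apply rangeI)+
  then show ?thesis
    using connected_component_segment[OF P Q] by blast
qed

text \<open>
  With functionals \<open>f\<close> dual to \<open>B \<union> C\<close> and a bijection \<open>j\<close> from \<open>B\<close> to \<open>C\<close>, the sums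
  \<open>g b = f b + f (j b)\<close> are biorthogonal to \<open>B\<close> as well as to \<open>C\<close>. Their common kernel is a closed
  complement of both spans.
\<close>

lemma connected_component_to_independent_range:
  assumes inf: "infinite_dimensional" and P: "P \<in> idempotents_of_rank n" and n: "n \<ge> 1"
    and B: "finite B" "span B = range (blinfun_apply P)" "card B = n"
    and C: "finite C" "card C = n" "B \<inter> C = {}" "independent (B \<union> C)"
  obtains Q where "Q \<in> idempotents_of_rank n" "range (blinfun_apply Q) = span C"
    "connected_component idempotents P Q"
proof -
  have "B \<noteq> {}"
    using B(3) n by auto
  obtain j where j: "bij_betw j B C"
    using finite_same_card_bij[OF B(1) C(1)] B(3) C(2) by auto
  have jC: "j b \<in> C" if "b \<in> B" for b
    using j that by (auto simp: bij_betw_def)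
  have jinj: "j b = j c \<longleftrightarrow> b = c" if "b \<in> B" "c \<in> B" for b c
    using j that by (auto simp: bij_betw_def inj_on_def)
  obtain f where f: "biorthogonal (B \<union> C) f id"
    using exists_dual_functionals[of "B \<union> C"] B(1) C(1,4) by auto
  have dual: "f b c = (if b = c then 1 else 0)" if "b \<in> B \<union> C" "c \<in> B \<union> C" for b c
    using biorthogonal_apply[OF f that] by simp
  define g where "g b x = f b x + f (j b) x" for b x
  have g: "g b \<in> bounded_functionals" if "b \<in> B" for b
    unfolding g_def using that jC by (intro functional_plus biorthogonal_functional[OF f]) auto
  have gB: "g b c = (if b = c then 1 else 0)" if "b \<in> B" "c \<in> B" for b c
    using that jC[of b] C(3) by (auto simp: g_def dual)
  have gC: "g b (j c) = (if b = c then 1 else 0)" if "b \<in> B" "c \<in> B" for b c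
    using that jC[of b] jC[of c] C(3) by (auto simp: g_def dual jinj)
  have bi: "biorthogonal B g id" "biorthogonal B g j"
    using g gB gC by (simp_all add: biorthogonal_def)
  let ?P = "finite_rank B g id" and ?Q = "finite_rank B g j"
  have P': "?P \<in> idempotents_of_rank n" "range (blinfun_apply ?P) = span B"
    using finite_rank_idempotent[OF inf B(1) \<open>B \<noteq> {}\<close> bi(1)] B(3) by simp_all
  have Q': "?Q \<in> idempotents_of_rank n" "range (blinfun_apply ?Q) = span C"
    using finite_rank_idempotent[OF inf B(1) \<open>B \<noteq> {}\<close> bi(2)] B(3) bij_betw_imp_surj_on[OF j]
    by simp_all
  have "connected_component idempotents ?P ?Q"
    using P'(1) Q'(1) finite_rank_compose[OF B(1)] bi
    by (intro connected_component_segment) (auto simp: idempotents_of_rank_def)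
  moreover have "connected_component idempotents P ?P"
    using P P' B(2) by (intro connected_component_same_range) (auto simp: idempotents_of_rank_def)
  ultimately show ?thesis
    using that Q' connected_component_trans by blast
qed

lemma exists_simultaneously_independent:
  assumes inf: "infinite_dimensional" and B: "finite B" "independent B"
    and H: "finite H" "independent H"
  obtains C where "finite C" "card C = n" "B \<inter> C = {}" "H \<inter> C = {}"
    "independent (B \<union> C)" "independent (H \<union> C)"
proof -
  have "\<exists>C. finite C \<and> card C = n \<and> B \<inter> C = {} \<and> H \<inter> C = {} \<and>
    independent (B \<union> C) \<and> independent (H \<union> C)"
  proof (induction n)
    case 0
    show ?case
      using B H by (intro exI[of _ "{}"]) simp
  next
    case (Suc n)
    then obtain C where C: "finite C" "card C = n" "B \<inter> C = {}" "H \<inter> C = {}"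
      "independent (B \<union> C)" "independent (H \<union> C)"
      by blast
    have "span (B \<union> H \<union> C) \<noteq> UNIV"
      using inf B(1) H(1) C(1) by (auto simp: infinite_dimensional_def)
    then obtain x where x: "x \<notin> span (B \<union> H \<union> C)"
      by blast
    have "x \<notin> span (B \<union> C)" "x \<notin> span (H \<union> C)"
      using x span_mono[of "B \<union> C" "B \<union> H \<union> C"] span_mono[of "H \<union> C" "B \<union> H \<union> C"] by auto
    moreover have "x \<notin> B \<union> H \<union> C"
      using x span_base[of x "B \<union> H \<union> C"] by blast
    ultimately have "independent (insert x (B \<union> C))" "independent (insert x (H \<union> C))"
      "finite (insert x C)" "card (insert x C) = Suc n"
      "B \<inter> insert x C = {}" "H \<inter> insert x C = {}"
      using C by (simp_all add: independent_insertI)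
    then show ?case
      by (intro exI[of _ "insert x C"]) simp
  qed
  then show ?thesis
    using that by blast
qed

lemma connected_component_idempotents_of_rank:
  assumes inf: "infinite_dimensional" and n: "n \<ge> 1"
    and P: "P \<in> idempotents_of_rank n" and Q: "Q \<in> idempotents_of_rank n"
  shows "connected_component idempotents P Q"
proof -
  have *: "\<exists>B. finite B \<and> independent B \<and> span B = range (blinfun_apply R) \<and> card B = n"
    if "R \<in> idempotents_of_rank n" for R
  proof -
    have "R \<in> idempotents" "dim (range (blinfun_apply R)) = n"
      using that by (simp_all add: idempotents_of_rank_def)
    then show ?thesis
      using finite_basis[OF subspace_range_operator[OF idempotent_operator] _ n] by metis
  qed
  obtain B where B: "finite B" "independent B" "span B = range (blinfun_apply P)" "card B = n"
    using *[OF P] by blast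
  obtain H where H: "finite H" "independent H" "span H = range (blinfun_apply Q)" "card H = n"
    using *[OF Q] by blast
  obtain C where C: "finite C" "card C = n" "B \<inter> C = {}" "H \<inter> C = {}"
    "independent (B \<union> C)" "independent (H \<union> C)"
    using exists_simultaneously_independent[OF inf B(1,2) H(1,2)] .
  obtain P' where P': "P' \<in> idempotents_of_rank n" "range (blinfun_apply P') = span C"
    "connected_component idempotents P P'"
    using connected_component_to_independent_range[OF inf P n B(1,3,4) C(1,2,3,5)] .
  obtain Q' where Q': "Q' \<in> idempotents_of_rank n" "range (blinfun_apply Q') = span C"
    "connected_component idempotents Q Q'"
    using connected_component_to_independent_range[OF inf Q n H(1,3,4) C(1,2,4,6)] .
  have "connected_component idempotents P' Q'"
    using P' Q' by (intro connected_component_same_range) (auto simp: idempotents_of_rank_def)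
  then show ?thesis
    using P'(3) Q'(3) by (meson connected_component_sym connected_component_trans)
qed

section \<open>Local constancy of the rank\<close>

text \<open>
  If \<open>P z = 0\<close> and \<open>Q z = z\<close>, then \<open>(P - Q) z = - z\<close>, which forces \<open>z = 0\<close>.
\<close>

lemma idempotent_inj_on_range:
  assumes P: "P \<in> idempotents" and Q: "Q \<in> idempotents" and close: "norm (P - Q) < 1"
  shows "inj_on (blinfun_apply P) (range (blinfun_apply Q))"
proof (rule inj_onI)
  fix x y
  assume xy: "x \<in> range (blinfun_apply Q)" "y \<in> range (blinfun_apply Q)"
    and eq: "blinfun_apply P x = blinfun_apply P y"
  let ?z = "x - y"
  have "blinfun_apply (P - Q) ?z = - ?z"
    using xy eq by (simp add: blinfun.diff_left blinfun.diff_right idempotent_range_iff[OF Q])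
  then have "norm ?z \<le> norm (P - Q) * norm ?z"
    using norm_blinfun[of "P - Q" ?z] by (metis norm_minus_cancel)
  then have "(1 - norm (P - Q)) * norm ?z \<le> 0"
    by (simp add: algebra_simps)
  then have "norm ?z \<le> 0"
    using close by (simp add: mult_le_0_iff)
  then show "x = y"
    by simp
qed

text \<open>
  Injectivity of \<open>Q\<close> on the range of \<open>P\<close> bounds the rank of \<open>P\<close> by \<open>n\<close> and also shows that it is
  finite; injectivity of \<open>P\<close> on the range of \<open>Q\<close> bounds it from below. The finiteness is essential for
  the lower bound, since \<open>dim\<close> takes the value \<open>0\<close> on infinite dimensional subspaces.
\<close>

lemma rank_locally_constant:
  assumes P: "P \<in> idempotents" and Q: "Q \<in> idempotents_of_rank n" and n: "n \<ge> 1"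
    and close: "norm (P - Q) < 1"
  shows "P \<in> idempotents_of_rank n"
proof -
  have Qi: "Q \<in> idempotents" and dimQ: "dim (range (blinfun_apply Q)) = n"
    using Q by (auto simp: idempotents_of_rank_def)
  have lin: "Vector_Spaces.linear scale scale (blinfun_apply P)"
    "Vector_Spaces.linear scale scale (blinfun_apply Q)"
    using P Qi by (auto intro: operator_linear idempotent_operator)
  have sub: "subspace (range (blinfun_apply P))" "subspace (range (blinfun_apply Q))"
    using P Qi by (auto intro: subspace_range_operator idempotent_operator)
  have "dim (range (blinfun_apply P)) = dim (blinfun_apply Q ` range (blinfun_apply P))"
    using dim_linear_image[OF lin(2) sub(1)] idempotent_inj_on_range[OF Qi P] close
    by (simp add: norm_minus_commute)
  also have "\<dots> \<le> dim (range (blinfun_apply Q))"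
    using n by (intro dim_mono_finite) (auto simp: sub dimQ)
  finally have le: "dim (range (blinfun_apply P)) \<le> n"
    by (simp add: dimQ)
  have "n = dim (blinfun_apply P ` range (blinfun_apply Q))"
    using dim_linear_image[OF lin(1) sub(2)] idempotent_inj_on_range[OF P Qi close] dimQ by simp
  also have "\<dots> \<le> dim (range (blinfun_apply P))"
  proof -
    obtain B where B: "B \<subseteq> range (blinfun_apply P)" "independent B"
      "range (blinfun_apply P) \<subseteq> span B" "card B = dim (range (blinfun_apply P))"
      using basis_exists by blast
    then have span: "span B = range (blinfun_apply P)"
      using sub(1) span_minimal by blast
    have inj: "inj_on (blinfun_apply Q) (range (blinfun_apply P))"
      using idempotent_inj_on_range[OF Qi P] close by (simp add: norm_minus_commute)
    obtain C where C: "finite C" "span C = range (blinfun_apply Q)"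
      using finite_basis[OF sub(2) dimQ n] by metis
    have "independent (blinfun_apply Q ` B)"
      using endo.linear_independent_injective_image[OF lin(2) B(2)] inj span by simp
    moreover have "blinfun_apply Q ` B \<subseteq> span C"
      using C(2) by blast
    ultimately have "finite (blinfun_apply Q ` B)"
      using independent_span_bound[OF C(1)] by blast
    then have "finite B"
      using inj B(1) by (meson finite_imageD inj_on_subset)
    moreover have "blinfun_apply P ` range (blinfun_apply Q) \<subseteq> span B"
      using span by blast
    ultimately show ?thesis
      using dim_le_card[of "blinfun_apply P ` range (blinfun_apply Q)" B] B(4) by simp
  qed
  finally show ?thesis
    using le P by (simp add: idempotents_of_rank_def)
qed

end

section \<open>The component of the idempotents\<close>

lemma connected_clopen_is_component:
  assumes C: "connectedin X C" and "C \<noteq> {}" and clopen: "openin X C" "closedin X C"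
  shows "C \<in> connected_components_of X"
proof -
  obtain x where x: "x \<in> C"
    using \<open>C \<noteq> {}\<close> by blast
  then have xX: "x \<in> topspace X"
    using C connectedin_subset_topspace by blast
  have "C \<subseteq> connected_component_of_set X x"
    using C x by (rule connected_component_of_maximal)
  moreover have "connected_component_of_set X x \<subseteq> C"
  proof -
    have "x \<in> connected_component_of_set X x"
      using xX by (simp add: connected_component_of_refl)
    then show ?thesis
      using connectedin_clopen_cases[OF connectedin_connected_component_of clopen(2,1), of x] x
      by (auto simp: disjnt_iff)
  qed
  ultimately have "C = connected_component_of_set X x"
    by (rule antisym)
  then show ?thesis
    using xX by (simp add: connected_component_in_connected_components_of)
qed

context banach_space_over
begin

lemma exists_subspace_of_dim:
  assumes inf: "infinite_dimensional"
  obtains V where "subspace V" "dim V = n"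
proof -
  obtain C where "card C = n" "independent ({} \<union> C)"
    using exists_simultaneously_independent[OF inf finite.emptyI independent_empty
        finite.emptyI independent_empty, of n] by metis
  then show ?thesis
    using that[of "span C"] by (simp add: dim_eq_card_independent)
qed

lemma idempotents_of_rank_nonempty:
  assumes "infinite_dimensional" "n \<ge> 1"
  shows "idempotents_of_rank n \<noteq> {}"
  using exists_subspace_of_dim[OF assms(1), of n] exists_idempotent_onto[OF assms(1) _ _ assms(2)]
  by (metis empty_iff)

lemma idempotents_of_rank_clopen:
  assumes "n \<ge> 1"
  shows "openin (top_of_set idempotents) (idempotents_of_rank n)"
    and "closedin (top_of_set idempotents) (idempotents_of_rank n)"
proof -
  have sub: "idempotents_of_rank n \<subseteq> idempotents"
    by (auto simp: idempotents_of_rank_def)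
  have near: "P \<in> idempotents_of_rank n \<longleftrightarrow> Q \<in> idempotents_of_rank n"
    if "P \<in> idempotents" "Q \<in> idempotents" "Q \<in> ball P 1" for P Q
    using that rank_locally_constant[of P Q n] rank_locally_constant[of Q P n] assms
    by (auto simp: dist_norm norm_minus_commute)
  show "openin (top_of_set idempotents) (idempotents_of_rank n)"
    unfolding openin_contains_ball
  proof (intro conjI ballI)
    fix P
    assume "P \<in> idempotents_of_rank n"
    then have "ball P 1 \<inter> idempotents \<subseteq> idempotents_of_rank n"
      using near sub by blast
    then show "\<exists>e>0. ball P e \<inter> idempotents \<subseteq> idempotents_of_rank n"
      using zero_less_one by blast
  qed (rule sub)
  have "openin (top_of_set idempotents) (idempotents - idempotents_of_rank n)"
    unfolding openin_contains_ball
  proof (intro conjI ballI)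
    fix P
    assume "P \<in> idempotents - idempotents_of_rank n"
    then have "ball P 1 \<inter> idempotents \<subseteq> idempotents - idempotents_of_rank n"
      using near by blast
    then show "\<exists>e>0. ball P e \<inter> idempotents \<subseteq> idempotents - idempotents_of_rank n"
      using zero_less_one by blast
  qed blast
  then show "closedin (top_of_set idempotents) (idempotents_of_rank n)"
    using sub by (simp add: closedin_def)
qed

lemma idempotents_of_rank_component:
  assumes inf: "infinite_dimensional" and n: "n \<ge> 1"
  shows "idempotents_of_rank n \<in> components idempotents"
proof -
  obtain P where P: "P \<in> idempotents_of_rank n"
    using idempotents_of_rank_nonempty[OF inf n] by blast
  have Pi: "P \<in> idempotents"
    using P by (simp add: idempotents_of_rank_def)
  let ?C = "connected_component_set idempotents P"
  have "idempotents_of_rank n \<subseteq> ?C"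
    using connected_component_idempotents_of_rank[OF inf n P] by blast
  moreover have "?C \<subseteq> idempotents_of_rank n"
  proof -
    have "connectedin (top_of_set idempotents) ?C"
      by (simp add: connectedin_subtopology connected_component_subset)
    moreover have "P \<in> ?C"
      using Pi by simp
    ultimately show ?thesis
      using connectedin_clopen_cases idempotents_of_rank_clopen[OF n] P
      by (metis disjnt_iff)
  qed
  ultimately have "idempotents_of_rank n = ?C"
    by (rule antisym)
  then show ?thesis
    using componentsI[OF Pi] by simp
qed

section \<open>The component of the Grassmannian\<close>

text \<open>
  Being the range of a bounded idempotent, a finite dimensional subspace is closed and complemented.
\<close>

lemma finite_dim_in_grassmannian_of_dim:
  assumes "infinite_dimensional" "subspace V" "dim V = n" "n \<ge> 1"
  shows "V \<in> grassmannian_of_dim n"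
proof -
  obtain Q where "Q \<in> idempotents_of_rank n" "range (blinfun_apply Q) = V"
    using exists_idempotent_onto[OF assms] .
  then show ?thesis
    using range_kernel_in_grassmannian(1)[of Q] assms(3)
    by (simp add: grassmannian_of_dim_def idempotents_of_rank_def)
qed

lemma range_image_idempotents_of_rank:
  assumes "infinite_dimensional" "n \<ge> 1"
  shows "(\<lambda>Q. range (blinfun_apply Q)) ` idempotents_of_rank n = grassmannian_of_dim n"
proof
  show "(\<lambda>Q. range (blinfun_apply Q)) ` idempotents_of_rank n \<subseteq> grassmannian_of_dim n"
    using range_kernel_in_grassmannian(1)
    unfolding idempotents_of_rank_def grassmannian_of_dim_def by blast
  show "grassmannian_of_dim n \<subseteq> (\<lambda>Q. range (blinfun_apply Q)) ` idempotents_of_rank n"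
  proof
    fix V
    assume "V \<in> grassmannian_of_dim n"
    then have "subspace V" "dim V = n"
      by (auto simp: grassmannian_of_dim_def grassmannian_def)
    then show "V \<in> (\<lambda>Q. range (blinfun_apply Q)) ` idempotents_of_rank n"
      using exists_idempotent_onto[OF assms(1) _ _ assms(2)] by (metis imageI)
  qed
qed

text \<open>
  The operator \<open>T\<close> is zero outside \<open>E\<close> and so in general not linear on the whole space. Replacing it by
  the linear extension \<open>L\<close> of its restriction to \<open>E\<close> makes the graph the image of \<open>E\<close> under the
  linear map \<open>x \<mapsto> x + L x\<close>, which is injective on \<open>E\<close>: if \<open>x = - T x\<close>, then \<open>x \<in> E \<inter> F\<close>.
\<close>

lemma graph_subspace_dim:
  assumes E: "subspace E" "E \<inter> F = {0}" and F: "subspace F" and T: "T \<in> operators_between E F"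
  shows "subspace (graph_map E T)" "dim (graph_map E T) = dim E"
proof -
  obtain B where B: "B \<subseteq> E" "independent B" "E \<subseteq> span B" "card B = dim E"
    using basis_exists by blast
  have span: "span B = E"
    using B E(1) span_minimal by blast
  obtain L where L: "Vector_Spaces.linear scale scale L" "\<And>b. b \<in> B \<Longrightarrow> L b = T b"
    using endo.linear_independent_extend[OF B(2), of T] by blast
  have TF: "T x \<in> F" if "x \<in> E" for x
    using T that by (auto simp: operators_between_def)
  have Tadd: "T (x + y) = T x + T y" if "x \<in> E" "y \<in> E" for x y
    using T that unfolding operators_between_def by blast
  have Tscale: "T (scale c x) = scale c (T x)" if "x \<in> E" for c x
    using T that unfolding operators_between_def by blast
  note Ladd = endo.linear_add[OF L(1)] and Lscale = endo.linear_scale[OF L(1)]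
  have "x \<in> E \<and> L x = T x" if "x \<in> span B" for x
    using that
  proof (induction rule: span_induct_alt)
    case base
    have "T 0 = 0"
      using Tscale[of 0 0] subspace_0[OF E(1)] by simp
    then show ?case
      using endo.linear_0[OF L(1)] subspace_0[OF E(1)] by simp
  next
    case (step c b y)
    then have "b \<in> E" "scale c b \<in> E"
      using B(1) subspace_scale[OF E(1)] by auto
    then show ?case
      using step by (simp add: Ladd Lscale L(2) Tadd Tscale subspace_add[OF E(1)])
  qed
  then have LT: "L x = T x" if "x \<in> E" for x
    using that span by blast
  have lin: "Vector_Spaces.linear scale scale (\<lambda>x. x + L x)"
    by (intro endo.linear_compose_add linear_ident L(1))
  have graph: "graph_map E T = (\<lambda>x. x + L x) ` E"
    unfolding graph_map_def by (intro image_cong) (simp_all add: LT)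
  have "inj_on (\<lambda>x. x + L x) E"
    unfolding endo.linear_inj_on_iff_eq_0[OF lin E(1)]
  proof (intro ballI impI)
    fix x
    assume x: "x \<in> E" and "x + L x = 0"
    then have "x = - T x"
      by (simp add: LT eq_neg_iff_add_eq_0)
    then have "x \<in> F"
      using subspace_neg[OF F TF[OF x]] by simp
    then show "x = 0"
      using x E(2) by blast
  qed
  then show "dim (graph_map E T) = dim E"
    unfolding graph using lin E(1) by (intro dim_linear_image)
  show "subspace (graph_map E T)"
    unfolding graph using lin E(1) by (intro endo.linear_subspace_image)
qed

text \<open>
  All graphs over \<open>E\<close> have the dimension of \<open>E\<close>. So \<open>grassmannian_of_dim n\<close> pulls back along a graph
  map to everything or to nothing. For the complement the pullback is nothing or the pullback of the
  whole topological space, which is open by the description of the open sets.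
\<close>

lemma grassmannian_of_dim_clopen:
  assumes inf: "infinite_dimensional" and n: "n \<ge> 1"
  shows "openin grassmannian_topology (grassmannian_of_dim n)"
    and "closedin grassmannian_topology (grassmannian_of_dim n)"
proof -
  let ?T = "topspace grassmannian_topology"
  have dim: "dim (graph_map E T) = dim E" and sub: "subspace (graph_map E T)"
    if "F \<in> grassmannian" "E \<in> closed_complements F" "T \<in> operators_between E F" for E F T
    using graph_subspace_dim[of E F T] that
    by (auto simp: grassmannian_def closed_complements_def)
  have all: "openin (operator_topology E F) (operators_between E F)"
    if "E \<in> closed_complements F" for E F
  proof -
    have "Metric_space (operators_between E F) (operator_dist E F)"
      using that by (intro Metric_space_operators) (auto simp: closed_complements_def)
    then show ?thesis
      unfolding operator_topology_def by (metis Metric_space.topspace_mtopology openin_topspace)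
  qed
  have graph_iff: "graph_map E T \<in> grassmannian_of_dim n \<longleftrightarrow> dim E = n"
    if "F \<in> grassmannian" "E \<in> closed_complements F" "T \<in> operators_between E F" for E F T
  proof
    show "graph_map E T \<in> grassmannian_of_dim n" if "dim E = n"
      using that dim[OF \<open>F \<in> _\<close> \<open>E \<in> _\<close> \<open>T \<in> _\<close>] sub[OF \<open>F \<in> _\<close> \<open>E \<in> _\<close> \<open>T \<in> _\<close>]
        finite_dim_in_grassmannian_of_dim[OF inf _ _ n] by metis
  qed (simp add: grassmannian_of_dim_def dim[OF that])
  show opn: "openin grassmannian_topology (grassmannian_of_dim n)"
    unfolding openin_grassmannian_topology
  proof (intro conjI ballI)
    show "grassmannian_of_dim n \<subseteq> grassmannian"
      by (auto simp: grassmannian_of_dim_def)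
    fix F E
    assume FE: "F \<in> grassmannian" "E \<in> closed_complements F"
    have "{T \<in> operators_between E F. graph_map E T \<in> grassmannian_of_dim n}
        = (if dim E = n then operators_between E F else {})"
      using graph_iff[OF FE] by auto
    then show "openin (operator_topology E F)
        {T \<in> operators_between E F. graph_map E T \<in> grassmannian_of_dim n}"
      using all[OF FE(2)] by simp
  qed
  have "openin grassmannian_topology (?T - grassmannian_of_dim n)"
    unfolding openin_grassmannian_topology
  proof (intro conjI ballI)
    have T: "?T \<subseteq> grassmannian \<and> (\<forall>F\<in>grassmannian. \<forall>E\<in>closed_complements F.
        openin (operator_topology E F) {T \<in> operators_between E F. graph_map E T \<in> ?T})"
      using openin_topspace[of grassmannian_topology] by (rule openin_grassmannian_topology[THEN iffD1])
    then show "?T - grassmannian_of_dim n \<subseteq> grassmannian"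
      by blast
    fix F E
    assume FE: "F \<in> grassmannian" "E \<in> closed_complements F"
    have "{T \<in> operators_between E F. graph_map E T \<in> ?T - grassmannian_of_dim n}
        = (if dim E = n then {} else {T \<in> operators_between E F. graph_map E T \<in> ?T})"
      using graph_iff[OF FE] by auto
    then show "openin (operator_topology E F)
        {T \<in> operators_between E F. graph_map E T \<in> ?T - grassmannian_of_dim n}"
      using T FE by simp
  qed
  then show "closedin grassmannian_topology (grassmannian_of_dim n)"
    using openin_subset[OF opn] by (simp add: closedin_def)
qed

text \<open>
  By equality of dimensions, \<open>P\<close> maps the range of \<open>Q\<close> bijectively onto \<open>E\<close>. The inverse \<open>S\<close> of this
  bijection satisfies \<open>P (S y - y) = 0\<close>, so that \<open>T = S - I\<close> maps \<open>E\<close> into the kernel of \<open>P\<close>, and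
  \<open>S\<close> maps \<open>E\<close> onto the range of \<open>Q\<close>. For the norm, \<open>T y = (Q - P) (S y)\<close>.
\<close>

lemma idempotent_range_as_graph:
  assumes P: "P \<in> idempotents_of_rank n" and Q: "Q \<in> idempotents_of_rank n" and n: "n \<ge> 1"
    and close: "norm (Q - P) \<le> 1 / 2"
  defines "E \<equiv> range (blinfun_apply P)" and "F \<equiv> {x. blinfun_apply P x = 0}"
  obtains T where "T \<in> operators_between E F" "graph_map E T = range (blinfun_apply Q)"
    "\<And>x. x \<in> E \<Longrightarrow> norm (T x) \<le> 2 * norm (Q - P) * norm x"
proof -
  have Pi: "P \<in> idempotents" and Qi: "Q \<in> idempotents"
    and dims: "dim E = n" "dim (range (blinfun_apply Q)) = n"
    using P Q by (auto simp: idempotents_of_rank_def E_def)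
  let ?G = "range (blinfun_apply Q)"
  have Pop: "P \<in> bounded_operators" and Qop: "Q \<in> bounded_operators"
    using Pi Qi by (auto intro: idempotent_operator)
  have lin: "Vector_Spaces.linear scale scale (blinfun_apply P)"
    using Pop by (rule operator_linear)
  have sub: "subspace E" "subspace ?G"
    unfolding E_def using Pop Qop by (auto intro: subspace_range_operator)
  have inj: "inj_on (blinfun_apply P) ?G"
    using idempotent_inj_on_range[OF Pi Qi] close by (simp add: norm_minus_commute)
  have onto: "blinfun_apply P ` ?G = E"
  proof (rule subspace_eq_if_dim_eq)
    show "blinfun_apply P ` ?G \<subseteq> E"
      by (auto simp: E_def)
    show "subspace (blinfun_apply P ` ?G)"
      using lin sub(2) by (rule endo.linear_subspace_image)
    show "dim (blinfun_apply P ` ?G) = dim E" "1 \<le> dim (blinfun_apply P ` ?G)"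
      using dim_linear_image[OF lin sub(2) inj] dims n by simp_all
  qed (rule sub)
  obtain S where S: "Vector_Spaces.linear scale scale S"
    and S_left: "\<And>x. x \<in> ?G \<Longrightarrow> S (blinfun_apply P x) = x"
    using endo.linear_exists_left_inverse_on[OF lin sub(2) inj] by blast
  have SG: "S y \<in> ?G" and PS: "blinfun_apply P (S y) = y" if "y \<in> E" for y
    using that S_left unfolding onto[symmetric] by (metis imageE)+
  define T where "T y = (if y \<in> E then S y - y else 0)" for y
  have bound: "norm (T y) \<le> 2 * norm (Q - P) * norm y" if y: "y \<in> E" for y
  proof -
    have QS: "blinfun_apply Q (S y) = S y"
      using SG[OF y] idempotent_range_iff[OF Qi] by simp
    have "T y = blinfun_apply (Q - P) (S y)"
      using y by (simp add: T_def blinfun.diff_left QS PS)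
    then have le: "norm (T y) \<le> norm (Q - P) * norm (S y)"
      by (simp add: norm_blinfun)
    \<comment> \<open>A first, crude bound for \<open>T y = S y - y\<close> yields \<open>\<parallel>S y\<parallel> \<le> 2 \<parallel>y\<parallel>\<close>.\<close>
    also have "\<dots> \<le> 1 / 2 * norm (S y)"
      using close by (intro mult_right_mono) simp_all
    finally have "norm (S y) \<le> 2 * norm y"
      using y norm_triangle_ineq2[of "S y" y] by (simp add: T_def)
    then have "norm (Q - P) * norm (S y) \<le> norm (Q - P) * (2 * norm y)"
      by (intro mult_left_mono) simp_all
    with le show ?thesis
      by simp
  qed
  show ?thesis
  proof
    show "norm (T x) \<le> 2 * norm (Q - P) * norm x" if "x \<in> E" for x
      using that by (rule bound)
    show "graph_map E T = ?G"
    proof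
      show "graph_map E T \<subseteq> ?G"
        using SG by (auto simp: graph_map_def T_def)
      show "?G \<subseteq> graph_map E T"
      proof
        fix x
        assume x: "x \<in> ?G"
        then have "blinfun_apply P x \<in> E" "x = blinfun_apply P x + T (blinfun_apply P x)"
          using S_left by (auto simp: T_def E_def)
        then show "x \<in> graph_map E T"
          unfolding graph_map_def by (rule rev_image_eqI)
      qed
    qed
    have "T y \<in> F" if "y \<in> E" for y
      using that idempotent_range_iff[OF Pi, of y]
      by (simp add: T_def F_def blinfun.diff_right PS) (simp add: E_def)
    moreover have "T (x + y) = T x + T y" if "x \<in> E" "y \<in> E" for x y
      using that by (simp add: T_def subspace_add[OF sub(1)] endo.linear_add[OF S])
    moreover have "T (scale c x) = scale c (T x)" if "x \<in> E" for c x
      using that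
      by (simp add: T_def subspace_scale[OF sub(1)] endo.linear_scale[OF S] scale_right_diff_distrib)
    moreover have "\<exists>K. \<forall>x\<in>E. norm (T x) \<le> K * norm x"
      using bound by blast
    moreover have "T x = 0" if "x \<notin> E" for x
      using that by (simp add: T_def)
    ultimately show "T \<in> operators_between E F"
      unfolding operators_between_def by blast
  qed
qed

text \<open>
  At an idempotent \<open>P\<close>, the chart given by the range \<open>E\<close> and the kernel \<open>F\<close> of \<open>P\<close> represents \<open>E\<close>
  by the zero operator. An open neighbourhood of \<open>E\<close> contains the graphs of all operators in some
  ball around zero, and hence the ranges of all idempotents of rank \<open>n\<close> that are close to \<open>P\<close>.
\<close>

lemma continuous_map_range:
  assumes inf: "infinite_dimensional" and n: "n \<ge> 1"
  shows "continuous_map (top_of_set (idempotents_of_rank n)) grassmannian_topology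
    (\<lambda>Q. range (blinfun_apply Q))"
  unfolding continuous_map_def
proof (intro conjI allI impI)
  have "grassmannian_of_dim n \<subseteq> topspace grassmannian_topology"
    using grassmannian_of_dim_clopen(1)[OF inf n] by (rule openin_subset)
  then show "(\<lambda>Q. range (blinfun_apply Q))
      \<in> topspace (top_of_set (idempotents_of_rank n)) \<rightarrow> topspace grassmannian_topology"
    using range_image_idempotents_of_rank[OF inf n] by auto
  fix U
  assume U: "openin grassmannian_topology U"
  have "\<exists>e>0. ball P e \<inter> idempotents_of_rank n
      \<subseteq> {Q \<in> idempotents_of_rank n. range (blinfun_apply Q) \<in> U}"
    if P: "P \<in> idempotents_of_rank n" and PU: "range (blinfun_apply P) \<in> U" for P
  proof -
    have Pi: "P \<in> idempotents"
      using P by (simp add: idempotents_of_rank_def)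
    define E where "E = range (blinfun_apply P)"
    define F where "F = {x. blinfun_apply P x = 0}"
    have FE: "F \<in> grassmannian" "E \<in> closed_complements F"
      unfolding E_def F_def using range_kernel_in_grassmannian(2) range_kernel_complementary(1) Pi
      by blast+
    have E: "subspace E" and F: "subspace F"
      using FE by (auto simp: grassmannian_def closed_complements_def)
    interpret M: Metric_space "operators_between E F" "operator_dist E F"
      using E by (rule Metric_space_operators)
    let ?O = "{T \<in> operators_between E F. graph_map E T \<in> U}"
    have opn: "openin M.mtopology ?O"
      using U FE unfolding openin_grassmannian_topology operator_topology_def by blast
    have zero: "(\<lambda>x. 0) \<in> operators_between E F"
      using subspace_0[OF F] by (auto simp: operators_between_def intro: exI[of _ 0])
    then have "(\<lambda>x. 0) \<in> ?O"
      using PU by (simp add: graph_map_def E_def)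
    then obtain r where r: "r > 0" "M.mball (\<lambda>x. 0) r \<subseteq> ?O"
      using opn unfolding M.openin_mtopology by blast
    have "range (blinfun_apply Q) \<in> U"
      if Q: "Q \<in> idempotents_of_rank n" and close: "norm (Q - P) < min (1/2) (r/2)" for Q
    proof -
      have "norm (Q - P) \<le> 1 / 2"
        using close by simp
      then obtain T where T: "T \<in> operators_between E F" "graph_map E T = range (blinfun_apply Q)"
        "\<And>x. x \<in> E \<Longrightarrow> norm (T x) \<le> 2 * norm (Q - P) * norm x"
        using idempotent_range_as_graph[OF P Q n] unfolding E_def F_def by metis
      have "operator_dist E F (\<lambda>x. 0) T = (SUP x\<in>E. norm (0 - T x) / norm x)"
        using zero T(1) by (simp add: operator_dist_def)
      also have "\<dots> \<le> 2 * norm (Q - P)"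
      proof (rule cSUP_least)
        show "E \<noteq> {}"
          by (simp add: E_def)
        show "norm (0 - T x) / norm x \<le> 2 * norm (Q - P)" if "x \<in> E" for x
          using T(3)[OF that] by (cases "x = 0") (simp_all add: field_simps)
      qed
      also have "\<dots> < r"
        using close by simp
      finally have "T \<in> M.mball (\<lambda>x. 0) r"
        using zero T(1) by simp
      then show ?thesis
        using r(2) T(2) by auto
    qed
    then show ?thesis
      using r(1) by (intro exI[of _ "min (1/2) (r/2)"]) (auto simp: dist_norm norm_minus_commute)
  qed
  then show "openin (top_of_set (idempotents_of_rank n))
      {Q \<in> topspace (top_of_set (idempotents_of_rank n)). range (blinfun_apply Q) \<in> U}"
    unfolding openin_contains_ball by auto
qed

lemma grassmannian_of_dim_component:
  assumes inf: "infinite_dimensional" and n: "n \<ge> 1"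
  shows "grassmannian_of_dim n \<in> connected_components_of grassmannian_topology"
proof (rule connected_clopen_is_component)
  have "connected (idempotents_of_rank n)"
    using idempotents_of_rank_component[OF inf n] by (rule in_components_connected)
  then have "connectedin (top_of_set (idempotents_of_rank n)) (idempotents_of_rank n)"
    by (simp add: connectedin_subtopology)
  from connectedin_continuous_map_image[OF continuous_map_range[OF inf n] this]
  show "connectedin grassmannian_topology (grassmannian_of_dim n)"
    by (simp add: range_image_idempotents_of_rank[OF inf n])
  show "grassmannian_of_dim n \<noteq> {}"
    using idempotents_of_rank_nonempty[OF inf n] range_image_idempotents_of_rank[OF inf n] by blast
qed (rule grassmannian_of_dim_clopen[OF inf n])+

end

theorem proposition5p4:
  fixes scale :: "'k::real_or_complex \<Rightarrow> 'a::banach \<Rightarrow> 'a" and n :: nat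
  assumes "banach_space_over scale"
    and "banach_space_over.infinite_dimensional scale"
    and "n \<ge> 1"
  shows "banach_space_over.idempotents_of_rank scale n
           \<in> components (banach_space_over.idempotents scale) \<and>
         banach_space_over.grassmannian_of_dim scale n
           \<in> connected_components_of (banach_space_over.grassmannian_topology scale)"
  using banach_space_over.idempotents_of_rank_component[OF assms]
    banach_space_over.grassmannian_of_dim_component[OF assms] by blast

end
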